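(* Let $K$ be a long virtual knot. For any $X\in\{F,G,H\}$ and $a,b\in\{0,1\}$, putting $a'=1-a$ and $b'=1-b$, we have the following. (i) $X_{ab}(K^{\#};t)=X_{ab}(-K;t)=X_{a'b'}(K;t)$. (ii) $X_{ab}(K^{*};t)=X_{ab}(K;t^{-1})$.
   Context: A long virtual knot diagram is an immersed line in $\mathbb{R}^2$ that agrees with the $x$-axis outside some $2$-disk and has finitely many transversal double points, each being either a real crossing (with over/under information) or a virtual crossing (without it); it is oriented from $-\infty$ to $\infty$. A long virtual knot is an equivalence class of such diagrams under generalized Reidemeister moves (the classical moves I, II, III on real crossings, the three analogous moves on virtual crossings, and the mixed move passing a strand having only virtual crossings across a real crossing). Let $D$ be a diagram of a long virtual knot $K$ with real crossings $c_1,\dots,c_n$, and let $\varepsilon_i\in\{1,-1\}$ be the sign of $c_i$. The crossing $c_i$ is of type $0$ if, travelling along $D$ from $-\infty$ to $\infty$, one passes $c_i$ first over and then under; otherwise it is of type $1$. For $a\in\{0,1\}$ put $I_a=\{i\mid c_i\text{ is of type }a\}$ and $\omega_a=\sum_{i\in I_a}\varepsilon_i$. A surface realization of $D$ is a closed, connected, oriented surface $\Sigma_g$ together with an oriented knot diagram on $\Sigma_g$ with a basepoint and with no virtual crossings, whose real crossings coincide with those of $D$ (same order of passage, over/under information and signs), and whose basepoint corresponds to $\pm\infty$ of $D$. Smoothing this diagram at $c_i$ (respecting orientation) gives two oriented loops on $\Sigma_g$: $\alpha_i$ is the one not containing the basepoint and $\beta_i$ is the one containing it; they are regarded as homology cycles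 on $\Sigma_g$. The intersection numbers $\gamma\cdot\gamma'\in\mathbb{Z}$ of such cycles are independent of the choice of surface realization. Put $W_a(K;t)=\sum_{i\in I_a}\varepsilon_i(t^{\alpha_i\cdot\beta_i}-1)$ and \[F_{ab}(K;t)=\sum_{i\in I_a,\,j\in I_b}\varepsilon_i\varepsilon_j(t^{\alpha_i\cdot\alpha_j}-1),\] \[G_{ab}(K;t)=\sum_{i\in I_a,\,j\in I_b}\varepsilon_i\varepsilon_j(t^{\alpha_i\cdot\beta_j}-1)-\omega_bW_a(K;t),\] \[H_{ab}(K;t)=\sum_{i\in I_a,\,j\in I_b}\varepsilon_i\varepsilon_j(t^{\beta_i\cdot\beta_j}-1)-\omega_aW_b(K;t)-\omega_bW_a(K;t^{-1}).\] These Laurent polynomials in $\mathbb{Z}[t,t^{-1}]$ depend only on $K$, not on $D$. From $D$ one constructs: $D^{\#}$, obtained by switching the over/under information at all real crossings of $D$; $-D$, obtained by reversing the orientation of $D$; and $D^{*}$, obtained from $D$ by an orientation-reversing homeomorphism of $\mathbb{R}^2$ (or of $\Sigma_g$, for a surface realization). The long virtual knots presented by $D^{\#}$, $-D$, $D^{*}$ are denoted by $K^{\#}$, $-K$, $K^{*}$, respectively. *)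

theory Defs
  imports "HOL-Analysis.Analysis" "HOL-Library.Poly_Mapping"
begin

section \<open>Long virtual knot diagrams\<close>

text \<open>
  The plane is \<^typ>\<open>complex\<close>. A diagram is a parametrized curve together with its real crossings;
  \<open>(x, y)\<close> in \<open>real_crossings\<close> means that the strand at parameter \<open>x\<close> passes over the strand at
  parameter \<open>y\<close>. The double points not listed there are the virtual crossings.
\<close>

record diagram =
  curve :: "real \<Rightarrow> complex"
  real_crossings :: "(real \<times> real) set"

definition double_points :: "(real \<Rightarrow> 'a) \<Rightarrow> (real \<times> real) set" where
  "double_points c = {(s, t). s \<noteq> t \<and> c s = c t}"

abbreviation velocity :: "(real \<Rightarrow> 'a::real_normed_vector) \<Rightarrow> real \<Rightarrow> 'a" where
  "velocity c t \<equiv> vector_derivative c (at t)"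

definition immersion :: "(real \<Rightarrow> 'a::real_normed_vector) \<Rightarrow> bool" where
  "immersion c \<longleftrightarrow> c C1_differentiable_on UNIV \<and> (\<forall>t. velocity c t \<noteq> 0)"

definition planar_cross :: "complex \<Rightarrow> complex \<Rightarrow> real" where
  "planar_cross v w = Re v * Im w - Im v * Re w"

text \<open>
  Since the curve is bounded on bounded parameter intervals, the second condition says that it agrees
  with the real axis, run through from left to right, outside some disk.
\<close>

definition long_virtual_diagram :: "diagram \<Rightarrow> bool" where
  "long_virtual_diagram D \<longleftrightarrow>
     immersion (curve D) \<and>
     (\<exists>r. \<forall>t. \<bar>t\<bar> \<ge> r \<longrightarrow> curve D t = of_real t) \<and>
     finite (double_points (curve D)) \<and>
     (\<forall>(s, t) \<in> double_points (curve D).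
        planar_cross (velocity (curve D) s) (velocity (curve D) t) \<noteq> 0) \<and>
     (\<forall>r s t. (r, s) \<in> double_points (curve D) \<and> (r, t) \<in> double_points (curve D) \<longrightarrow> s = t) \<and>
     real_crossings D \<subseteq> double_points (curve D) \<and>
     (\<forall>x y. (x, y) \<in> real_crossings D \<longrightarrow> (y, x) \<notin> real_crossings D)"

definition crossing_sign :: "diagram \<Rightarrow> real \<times> real \<Rightarrow> int" where
  "crossing_sign D = (\<lambda>(x, y). \<lfloor>sgn (planar_cross (velocity (curve D) x) (velocity (curve D) y))\<rfloor>)"

definition crossing_type :: "real \<times> real \<Rightarrow> nat" where
  "crossing_type = (\<lambda>(x, y). if x < y then 0 else 1)"

definition crossings_of_type :: "diagram \<Rightarrow> nat \<Rightarrow> (real \<times> real) set" where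
  "crossings_of_type D a = {i \<in> real_crossings D. crossing_type i = a}"

definition writhe :: "diagram \<Rightarrow> nat \<Rightarrow> int" where
  "writhe D a = (\<Sum>i\<in>crossings_of_type D a. crossing_sign D i)"


section \<open>Generalized Reidemeister moves and long virtual knots\<close>

text \<open>
  Planar isotopy and reparametrization. By the Alexander trick, a homeomorphism of the plane that is
  the identity outside a bounded set is isotopic to the identity.
\<close>

definition planar_isotopic :: "diagram \<Rightarrow> diagram \<Rightarrow> bool" where
  "planar_isotopic D D' \<longleftrightarrow>
     (\<exists>h k \<phi>. homeomorphism UNIV UNIV h k \<and> bounded {z. h z \<noteq> z} \<and>
        strict_mono \<phi> \<and> surj \<phi> \<and>
        curve D' = h \<circ> curve D \<circ> \<phi> \<and>
        real_crossings D' = {(x, y). (\<phi> x, \<phi> y) \<in> real_crossings D})"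

definition strand :: "real set \<Rightarrow> bool" where
  "strand A \<longleftrightarrow> (\<exists>a b. a < b \<and> A = {a..b})"

text \<open>
  The diagrams differ only inside a disk, and \<open>T\<close> is the set of parameters for which they run
  inside the disk. Up to planar isotopy, it suffices to consider round disks.
\<close>

definition differ_in_disk :: "real set \<Rightarrow> diagram \<Rightarrow> diagram \<Rightarrow> bool" where
  "differ_in_disk T D D' \<longleftrightarrow>
     (\<exists>z r. r > 0 \<and> curve D -` cball z r = T \<and> curve D' -` cball z r = T) \<and>
     (\<forall>t. t \<notin> T \<longrightarrow> curve D t = curve D' t) \<and>
     real_crossings D - T \<times> T = real_crossings D' - T \<times> T"

text \<open>
  In the three moves below, an arc system in a disk with the prescribed crossings is determined up
  to isotopy of the disk (and, for the second and third move, includes an empty bigon or triangle),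
  so these are exactly the usual local pictures, with all possible orientations.
\<close>

text \<open>Move I: a kink, with a real (of either kind) or virtual crossing, is created.\<close>

definition move_I :: "diagram \<Rightarrow> diagram \<Rightarrow> bool" where
  "move_I D D' \<longleftrightarrow>
     (\<exists>A. strand A \<and> differ_in_disk A D D' \<and>
        double_points (curve D) \<inter> A \<times> A = {} \<and>
        (\<exists>s t. s \<noteq> t \<and> double_points (curve D') \<inter> A \<times> A = {(s, t), (t, s)}))"

text \<open>Move II: two crossings are created, both virtual or both real with \<open>A\<close> passing over \<open>B\<close>.\<close>

definition move_II :: "diagram \<Rightarrow> diagram \<Rightarrow> bool" where
  "move_II D D' \<longleftrightarrow>
     (\<exists>A B. strand A \<and> strand B \<and> A \<inter> B = {} \<and> differ_in_disk (A \<union> B) D D' \<and>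
        double_points (curve D) \<inter> (A \<union> B) \<times> (A \<union> B) = {} \<and>
        double_points (curve D') \<inter> (A \<times> A \<union> B \<times> B) = {} \<and>
        card (double_points (curve D') \<inter> A \<times> B) = 2 \<and>
        real_crossings D' \<inter> (A \<union> B) \<times> (A \<union> B)
          \<in> {{}, double_points (curve D') \<inter> A \<times> B})"

definition crossing_params :: "diagram \<Rightarrow> real set \<Rightarrow> real set \<Rightarrow> real set" where
  "crossing_params D A B = {s \<in> A. \<exists>t\<in>B. curve D s = curve D t}"

definition order_reversed :: "diagram \<Rightarrow> diagram \<Rightarrow> real set \<Rightarrow> real set \<Rightarrow> real set \<Rightarrow> bool" where
  "order_reversed D D' A B C \<longleftrightarrow>
     (\<forall>s \<in> crossing_params D A B. \<forall>t \<in> crossing_params D A C.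
      \<forall>s' \<in> crossing_params D' A B. \<forall>t' \<in> crossing_params D' A C. s < t \<longleftrightarrow> t' < s')"

definition pairwise_crossing_once :: "diagram \<Rightarrow> real set \<Rightarrow> real set \<Rightarrow> real set \<Rightarrow> bool" where
  "pairwise_crossing_once D A B C \<longleftrightarrow>
     double_points (curve D) \<inter> (A \<times> A \<union> B \<times> B \<union> C \<times> C) = {} \<and>
     card (double_points (curve D) \<inter> A \<times> B) = 1 \<and>
     card (double_points (curve D) \<inter> A \<times> C) = 1 \<and>
     card (double_points (curve D) \<inter> B \<times> C) = 1"

text \<open>
  Move III: three strands bounding a triangle, along each of which the order of the two crossings is
  reversed. The three choices of \<open>P\<close> are: all crossings real, \<open>A\<close> being on top and \<open>C\<close> at the bottom
  (classical move); all crossings virtual; and the crossing of \<open>A\<close> and \<open>B\<close> real and \<open>C\<close> having only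
  virtual crossings (mixed move).
\<close>

definition move_III :: "diagram \<Rightarrow> diagram \<Rightarrow> bool" where
  "move_III D D' \<longleftrightarrow>
     (\<exists>A B C. strand A \<and> strand B \<and> strand C \<and> A \<inter> B = {} \<and> A \<inter> C = {} \<and> B \<inter> C = {} \<and>
        differ_in_disk (A \<union> B \<union> C) D D' \<and>
        pairwise_crossing_once D A B C \<and> pairwise_crossing_once D' A B C \<and>
        order_reversed D D' A B C \<and> order_reversed D D' B A C \<and> order_reversed D D' C A B \<and>
        (\<exists>P \<in> {A \<times> B \<union> A \<times> C \<union> B \<times> C, {}, A \<times> B}.
          \<forall>E \<in> {D, D'}. real_crossings E \<inter> (A \<union> B \<union> C) \<times> (A \<union> B \<union> C)
                           = double_points (curve E) \<inter> P))"

definition move :: "diagram \<Rightarrow> diagram \<Rightarrow> bool" where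
  "move D D' \<longleftrightarrow> long_virtual_diagram D \<and> long_virtual_diagram D' \<and>
     (planar_isotopic D D' \<or> move_I D D' \<or> move_II D D' \<or> move_III D D')"

definition knot_of :: "diagram \<Rightarrow> diagram set" where
  "knot_of D = {D'. equivclp move D D'}"

definition long_virtual_knots :: "diagram set set" where
  "long_virtual_knots = knot_of ` {D. long_virtual_diagram D}"


section \<open>Operations on diagrams and knots\<close>

definition switch :: "diagram \<Rightarrow> diagram" where
  "switch D = D\<lparr>real_crossings := (real_crossings D)\<inverse>\<rparr>"

text \<open>
  The reversed line runs from \<open>\<infinity>\<close> to \<open>-\<infinity>\<close> along the real axis; the plane is rotated by a half turn to
  make it a long diagram again.
\<close>

definition reverse :: "diagram \<Rightarrow> diagram" where
  "reverse D = \<lparr>curve = (\<lambda>t. - curve D (- t)),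
                real_crossings = {(x, y). (- x, - y) \<in> real_crossings D}\<rparr>"

definition mirror :: "diagram \<Rightarrow> diagram" where
  "mirror D = D\<lparr>curve := (\<lambda>t. cnj (curve D t))\<rparr>"

text \<open>The knot presented by \<open>f D\<close> for \<open>D\<close> presenting \<open>K\<close>.\<close>

definition lift_to_knots :: "(diagram \<Rightarrow> diagram) \<Rightarrow> diagram set \<Rightarrow> diagram set" where
  "lift_to_knots f K = (\<Union>D\<in>K. knot_of (f D))"


section \<open>Intersection numbers on closed oriented surfaces\<close>

text \<open>
  Every closed oriented surface embeds in three-space, so closed oriented surfaces are compact
  submanifolds of \<^typ>\<open>real ^ 3\<close>, oriented by a unit normal field \<open>\<nu>\<close>: locally \<open>S\<close> is the zero set of
  a continuously differentiable \<open>f\<close> with nowhere vanishing gradient \<open>g\<close>, and \<open>\<nu> = g / norm g\<close>.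
  A basis \<open>v, w\<close> of a tangent plane is positive if \<open>\<nu>, v, w\<close> is a positive basis of three-space.
\<close>

definition closed_oriented_surface :: "(real ^ 3) set \<Rightarrow> (real ^ 3 \<Rightarrow> real ^ 3) \<Rightarrow> bool" where
  "closed_oriented_surface S \<nu> \<longleftrightarrow> S \<noteq> {} \<and> compact S \<and> connected S \<and>
     (\<forall>p\<in>S. \<exists>U f g. open U \<and> p \<in> U \<and>
        (\<forall>x\<in>U. (f has_derivative (\<lambda>v. g x \<bullet> v)) (at x) \<and> g x \<noteq> 0) \<and>
        continuous_on U g \<and>
        S \<inter> U = {x \<in> U. f x = (0::real)} \<and>
        (\<forall>x \<in> S \<inter> U. \<nu> x = sgn (g x)))"

definition surface_cross :: "(real ^ 3 \<Rightarrow> real ^ 3) \<Rightarrow> real ^ 3 \<Rightarrow> real ^ 3 \<Rightarrow> real ^ 3 \<Rightarrow> real" where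
  "surface_cross \<nu> p v w = \<nu> p \<bullet> cross3 v w"

definition closed_curve_on :: "(real ^ 3) set \<Rightarrow> (real \<Rightarrow> real ^ 3) \<Rightarrow> bool" where
  "closed_curve_on S c \<longleftrightarrow> c C1_differentiable_on UNIV \<and> (\<forall>t. c (t + 1) = c t) \<and> range c \<subseteq> S"

definition intersections :: "(real \<Rightarrow> 'a) \<Rightarrow> (real \<Rightarrow> 'a) \<Rightarrow> (real \<times> real) set" where
  "intersections p q = {(s, t) \<in> {0..<1} \<times> {0..<1}. p s = q t}"

definition transverse :: "(real ^ 3 \<Rightarrow> real ^ 3) \<Rightarrow> (real \<Rightarrow> real ^ 3) \<Rightarrow> (real \<Rightarrow> real ^ 3) \<Rightarrow> bool" where
  "transverse \<nu> p q \<longleftrightarrow> finite (intersections p q) \<and>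
     (\<forall>(s, t) \<in> intersections p q. surface_cross \<nu> (p s) (velocity p s) (velocity q t) \<noteq> 0)"

definition signed_count :: "(real ^ 3 \<Rightarrow> real ^ 3) \<Rightarrow> (real \<Rightarrow> real ^ 3) \<Rightarrow> (real \<Rightarrow> real ^ 3) \<Rightarrow> int" where
  "signed_count \<nu> p q =
     (\<Sum>(s, t) \<in> intersections p q. \<lfloor>sgn (surface_cross \<nu> (p s) (velocity p s) (velocity q t))\<rfloor>)"

text \<open>
  The common value of a quantity computed from auxiliary choices, with the convention that it is \<open>0\<close>
  should the value depend on the choices or not exist.
\<close>

definition common_value :: "('a::zero \<Rightarrow> bool) \<Rightarrow> 'a" where
  "common_value P = (if \<exists>!x. P x then THE x. P x else 0)"

text \<open>
  The intersection number of the homology classes of two (merely continuous) loops, computed from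
  transverse continuously differentiable loops freely homotopic to them.
\<close>

definition intersection_number ::
  "(real ^ 3) set \<Rightarrow> (real ^ 3 \<Rightarrow> real ^ 3) \<Rightarrow> (real \<Rightarrow> real ^ 3) \<Rightarrow> (real \<Rightarrow> real ^ 3) \<Rightarrow> int" where
  "intersection_number S \<nu> p q = common_value (\<lambda>n. \<exists>p' q'.
     closed_curve_on S p' \<and> closed_curve_on S q' \<and>
     homotopic_loops S p p' \<and> homotopic_loops S q q' \<and>
     transverse \<nu> p' q' \<and> n = signed_count \<nu> p' q')"


section \<open>Surface realizations\<close>

text \<open>
  A knot diagram on a surface is a 1-periodic immersion with basepoint at parameter \<open>0\<close>. The function
  \<open>param\<close> sends the parameters of the real crossings of the long diagram to those of the corresponding
  crossings on the surface; the over/under information of the latter is transported along it.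
\<close>

record realization =
  surf :: "(real ^ 3) set"
  normal :: "real ^ 3 \<Rightarrow> real ^ 3"
  knot :: "real \<Rightarrow> real ^ 3"
  param :: "real \<Rightarrow> real"

text \<open>
  The fourth condition says that the double points of the knot diagram, which are all different from
  the basepoint, are exactly the real crossings of \<open>D\<close>. In particular there are no virtual crossings
  and no triple points.
\<close>

definition surface_realization :: "diagram \<Rightarrow> realization \<Rightarrow> bool" where
  "surface_realization D R \<longleftrightarrow>
     closed_oriented_surface (surf R) (normal R) \<and>
     immersion (knot R) \<and> closed_curve_on (surf R) (knot R) \<and>
     double_points (knot R) \<inter> {0..<1} \<times> {0..<1}
       = map_prod (param R) (param R) ` (real_crossings D \<union> (real_crossings D)\<inverse>) \<and>
     param R ` Field (real_crossings D) \<subseteq> {0<..<1} \<and>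
     strict_mono_on (Field (real_crossings D)) (param R) \<and>
     (\<forall>(x, y) \<in> real_crossings D.
        surface_cross (normal R) (knot R (param R x))
          (velocity (knot R) (param R x)) (velocity (knot R) (param R y)) \<noteq> 0 \<and>
        \<lfloor>sgn (surface_cross (normal R) (knot R (param R x))
          (velocity (knot R) (param R x)) (velocity (knot R) (param R y)))\<rfloor> = crossing_sign D (x, y))"

text \<open>
  Smoothing at a crossing passed at the times \<open>0 < s < t < 1\<close> yields the loop run through from \<open>s\<close> to
  \<open>t\<close> and the loop run through from \<open>t\<close> to \<open>s + 1\<close>; the latter contains the basepoint.
\<close>

definition loop_alpha :: "realization \<Rightarrow> real \<times> real \<Rightarrow> real \<Rightarrow> real ^ 3" where
  "loop_alpha R = (\<lambda>(x, y). subpath (param R (min x y)) (param R (max x y)) (knot R))"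

definition loop_beta :: "realization \<Rightarrow> real \<times> real \<Rightarrow> real \<Rightarrow> real ^ 3" where
  "loop_beta R = (\<lambda>(x, y). subpath (param R (max x y)) (param R (min x y) + 1) (knot R))"

abbreviation int_num :: "realization \<Rightarrow> (real \<Rightarrow> real ^ 3) \<Rightarrow> (real \<Rightarrow> real ^ 3) \<Rightarrow> int" where
  "int_num R \<equiv> intersection_number (surf R) (normal R)"


section \<open>The invariants\<close>

text \<open>
  The ring of integral Laurent polynomials in \<open>t\<close> is the convolution ring \<open>int \<Rightarrow>\<^sub>0 int\<close>, where the
  value at \<open>k\<close> is the coefficient of the \<open>k\<close>-th power of \<open>t\<close>.
\<close>

type_synonym laurent = "int \<Rightarrow>\<^sub>0 int"

definition t_pow :: "int \<Rightarrow> laurent" where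
  "t_pow k = Poly_Mapping.single k 1"

definition subst_inverse :: "laurent \<Rightarrow> laurent" where
  "subst_inverse p = Poly_Mapping.map_key uminus p"

definition W_poly :: "nat \<Rightarrow> diagram \<Rightarrow> realization \<Rightarrow> laurent" where
  "W_poly a D R = (\<Sum>i\<in>crossings_of_type D a.
     of_int (crossing_sign D i) * (t_pow (int_num R (loop_alpha R i) (loop_beta R i)) - 1))"

definition pair_sum ::
  "(realization \<Rightarrow> real \<times> real \<Rightarrow> real \<Rightarrow> real ^ 3) \<Rightarrow> (realization \<Rightarrow> real \<times> real \<Rightarrow> real \<Rightarrow> real ^ 3)
   \<Rightarrow> nat \<Rightarrow> nat \<Rightarrow> diagram \<Rightarrow> realization \<Rightarrow> laurent" where
  "pair_sum \<gamma> \<delta> a b D R = (\<Sum>i\<in>crossings_of_type D a. \<Sum>j\<in>crossings_of_type D b.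
     of_int (crossing_sign D i * crossing_sign D j) * (t_pow (int_num R (\<gamma> R i) (\<delta> R j)) - 1))"

definition F_poly :: "nat \<Rightarrow> nat \<Rightarrow> diagram \<Rightarrow> realization \<Rightarrow> laurent" where
  "F_poly a b D R = pair_sum loop_alpha loop_alpha a b D R"

definition G_poly :: "nat \<Rightarrow> nat \<Rightarrow> diagram \<Rightarrow> realization \<Rightarrow> laurent" where
  "G_poly a b D R = pair_sum loop_alpha loop_beta a b D R - of_int (writhe D b) * W_poly a D R"

definition H_poly :: "nat \<Rightarrow> nat \<Rightarrow> diagram \<Rightarrow> realization \<Rightarrow> laurent" where
  "H_poly a b D R = pair_sum loop_beta loop_beta a b D R
     - of_int (writhe D a) * W_poly b D R
     - of_int (writhe D b) * subst_inverse (W_poly a D R)"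

definition knot_invariant :: "(diagram \<Rightarrow> realization \<Rightarrow> laurent) \<Rightarrow> diagram set \<Rightarrow> laurent" where
  "knot_invariant f K = common_value (\<lambda>p. \<exists>D\<in>K. \<exists>R. surface_realization D R \<and> p = f D R)"

definition F_inv :: "nat \<Rightarrow> nat \<Rightarrow> diagram set \<Rightarrow> laurent" where
  "F_inv a b = knot_invariant (F_poly a b)"

definition G_inv :: "nat \<Rightarrow> nat \<Rightarrow> diagram set \<Rightarrow> laurent" where
  "G_inv a b = knot_invariant (G_poly a b)"

definition H_inv :: "nat \<Rightarrow> nat \<Rightarrow> diagram set \<Rightarrow> laurent" where
  "H_inv a b = knot_invariant (H_poly a b)"

end

theory Submission
  imports Defs
begin

text \<open>
  The invariants are common values, taken over all diagrams \<open>D\<close> of \<open>K\<close> and all surface realizations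
  \<open>R\<close> of \<open>D\<close>, of polynomials computed from \<open>D\<close> and \<open>R\<close>. Each of the three operations is an involution
  on diagrams that maps moves to moves, so the diagrams of the new knot are exactly the images of the
  diagrams of \<open>K\<close> (\<open>lift_to_knots_eq_image\<close>). Each also comes with an involution on realizations:
  switching keeps the realization, reversal runs the knot on the surface backwards, and the mirror image
  reverses the orientation of the surface. Hence the possible values for the new knot are the images of those
  for \<open>K\<close> under a bijection of Laurent polynomials, and therefore the common values correspond under this
  bijection (\<open>common_value_image\<close>, \<open>knot_invariant_lift\<close>).

  It remains to compare the polynomials for one diagram, and this only involves how types, signs and intersection
  numbers change.
  \<^item> Switching exchanges the types, negates all signs and keeps the smoothing loops.
  \<^item> Reversal exchanges the types, keeps the signs and reverses all smoothing loops; reversing both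
    arguments does not change an intersection number.
  \<^item> The mirror image keeps the types and negates all signs and all intersection numbers.

  A simultaneous change of all signs cancels, since every term of the polynomials is
  quadratic in the signs: a product of two signs, or a writhe times a polynomial that is linear in
  the signs. Negating the intersection numbers replaces \<open>t\<close> by its inverse. This is the content of the locale
  \<open>crossing_correspondence\<close>.

  That the operations respect the moves is checked by means of the locale \<open>plane_symmetry\<close> for reversal
  and mirror image, whose effect on a diagram is composition with a symmetry of the plane and a reflection
  or the identity of the parameter line, and directly for switching.
\<close>

section \<open>Common values and velocities of transformed curves\<close>

text \<open>
  An injective map carries a unique value to a unique value. If there is no unique value on one side,
  then there is none on the other, and \<open>\<tau>\<close> preserves the default value \<open>0\<close>.
\<close>

lemma common_value_image:
  assumes "inj \<tau>" and "\<tau> 0 = 0" and P': "\<And>q. P' q \<longleftrightarrow> (\<exists>p. P p \<and> q = \<tau> p)"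
  shows "common_value P' = \<tau> (common_value P)"
proof -
  have image: "P' (\<tau> p)" if "P p" for p
    by (rule iffD2[OF P']) (intro exI[of _ p] conjI that refl)
  have ex1: "\<exists>!q. P' q" and the: "(THE q. P' q) = \<tau> (THE p. P p)" if ex1_P: "\<exists>!p. P p"
  proof -
    have P'_the: "P' (\<tau> (THE p. P p))"
      by (rule image[OF theI'[OF ex1_P]])
    have unique: "q = \<tau> (THE p. P p)" if q: "P' q" for q
    proof -
      obtain p where "P p" "q = \<tau> p" using iffD1[OF P' q] by (elim exE conjE)
      then show ?thesis using the1_equality[OF ex1_P] by simp
    qed
    show "\<exists>!q. P' q" using P'_the unique by (rule ex1I)
    show "(THE q. P' q) = \<tau> (THE p. P p)" using P'_the unique by (rule the_equality)
  qed
  have ex1_conv: "\<exists>!p. P p" if ex1_P': "\<exists>!q. P' q"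
  proof -
    obtain p where p: "P p" using iffD1[OF P' theI'[OF ex1_P']] by (elim exE conjE)
    have "r = p" if "P r" for r
      using the1_equality[OF ex1_P' image[OF that]] the1_equality[OF ex1_P' image[OF p]] assms(1)
      by (simp add: inj_eq)
    with p show ?thesis by (rule ex1I)
  qed
  from ex1 ex1_conv have "(\<exists>!q. P' q) \<longleftrightarrow> (\<exists>!p. P p)" by (rule iffI[rotated])
  with the assms(2) show ?thesis
    by (cases "\<exists>!p. P p") (simp_all only: common_value_def if_True if_False)
qed

lemma floor_minus_sgn: "\<lfloor>- sgn x :: real\<rfloor> = - \<lfloor>sgn x\<rfloor>"
  by (simp add: sgn_if floor_eq_iff)

text \<open>
  All curves that occur arise from given ones by an affine change of the parameter (reversal, shift by
  a period) followed by a linear map (half turn, conjugation, identity).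
\<close>

lemma has_vector_derivative_affine_linear:
  fixes c :: "real \<Rightarrow> 'a::real_normed_vector"
  assumes "bounded_linear g" and "(c has_vector_derivative v) (at (m * t + b))"
  shows "((\<lambda>t. g (c (m * t + b))) has_vector_derivative m *\<^sub>R g v) (at t)"
proof -
  have "((\<lambda>t. m * t + b) has_vector_derivative m) (at t)"
    by (auto intro!: derivative_eq_intros simp: has_real_derivative_iff_has_vector_derivative[symmetric])
  from vector_diff_chain_at[OF this assms(2)]
  have "((\<lambda>t. c (m * t + b)) has_vector_derivative m *\<^sub>R v) (at t)" by (simp add: o_def)
  from bounded_linear.has_vector_derivative[OF assms(1) this]
  show ?thesis using assms(1) by (simp add: linear_simps(5))
qed

lemma velocity_affine_linear:
  fixes c :: "real \<Rightarrow> 'a::real_normed_vector"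
  assumes "bounded_linear g" and "c C1_differentiable_on UNIV"
  shows "velocity (\<lambda>t. g (c (m * t + b))) t = m *\<^sub>R g (velocity c (m * t + b))"
proof -
  have "(c has_vector_derivative velocity c (m * t + b)) (at (m * t + b))"
    using assms(2) by (simp add: C1_differentiable_on_eq flip: vector_derivative_works)
  from has_vector_derivative_affine_linear[OF assms(1) this] show ?thesis
    by (rule vector_derivative_at)
qed

lemma C1_differentiable_affine_linear:
  fixes c :: "real \<Rightarrow> 'a::real_normed_vector"
  assumes g: "bounded_linear g" and "c C1_differentiable_on UNIV"
  shows "(\<lambda>t. g (c (m * t + b))) C1_differentiable_on UNIV"
proof -
  obtain v where v: "\<And>t. (c has_vector_derivative v t) (at t)" "continuous_on UNIV v"
    using assms(2) by (auto simp: C1_differentiable_on_def)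
  have "continuous_on UNIV (\<lambda>t. m *\<^sub>R g (v (m * t + b)))"
    by (intro continuous_intros bounded_linear.continuous_on[OF g]
        continuous_on_compose2[OF v(2)]) auto
  then show ?thesis
    using has_vector_derivative_affine_linear[OF g v(1)]
    by (auto simp: C1_differentiable_on_def intro!: exI[of _ "\<lambda>t. m *\<^sub>R g (v (m * t + b))"])
qed

lemma immersion_affine_linear:
  fixes c :: "real \<Rightarrow> 'a::real_normed_vector"
  assumes "bounded_linear g" and "\<And>v. g v = 0 \<Longrightarrow> v = 0" and "m \<noteq> 0" and "immersion c"
  shows "immersion (\<lambda>t. g (c (m * t + b)))"
  using assms by (auto simp: immersion_def velocity_affine_linear C1_differentiable_affine_linear)

section \<open>Intersection numbers\<close>

lemma homotopic_loops_reversepath: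
  assumes "homotopic_loops S p q"
  shows "homotopic_loops S (reversepath p) (reversepath q)"
proof -
  obtain h :: "real \<times> real \<Rightarrow> 'a" where
    h: "continuous_on ({0..1} \<times> {0..1}) h" "h \<in> ({0..1} \<times> {0..1}) \<rightarrow> S"
      "\<And>x. x \<in> {0..1} \<Longrightarrow> h (0, x) = p x" "\<And>x. x \<in> {0..1} \<Longrightarrow> h (1, x) = q x"
      "\<And>t. t \<in> {0..1} \<Longrightarrow> pathfinish (h \<circ> Pair t) = pathstart (h \<circ> Pair t)"
    using assms unfolding homotopic_loops by blast
  let ?h = "h \<circ> (\<lambda>y. (fst y, 1 - snd y))"
  show ?thesis unfolding homotopic_loops
  proof (intro exI[of _ ?h] conjI ballI)
    show "continuous_on ({0..1} \<times> {0..1}) ?h"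
      by (intro continuous_on_compose continuous_intros continuous_on_subset[OF h(1)]) auto
    show "?h \<in> ({0..1} \<times> {0..1}) \<rightarrow> S" using h(2) by (auto simp: Pi_iff)
  qed (use h(3-5) in \<open>auto simp: reversepath_def pathstart_def pathfinish_def\<close>)
qed

lemma velocity_reversepath:
  "c C1_differentiable_on UNIV \<Longrightarrow> velocity (reversepath c) t = - velocity c (1 - t)"
  using velocity_affine_linear[of "\<lambda>x. x" c "-1" 1 t] by (simp add: reversepath_def[abs_def] bounded_linear_ident)

lemma closed_curve_on_reversepath:
  assumes "closed_curve_on S c"
  shows "closed_curve_on S (reversepath c)"
proof -
  have "c (1 - t) = c (- t)" for t
  proof -
    have "c (- t + 1) = c (- t)" using assms unfolding closed_curve_on_def by blast
    then show ?thesis by simp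
  qed
  moreover have "reversepath c (t + 1) = c (- t)" for t
    by (simp add: reversepath_def)
  ultimately have "reversepath c (t + 1) = reversepath c t" for t
    by (simp only: reversepath_def)
  then show ?thesis
    using C1_differentiable_affine_linear[of "\<lambda>x. x" c "-1" 1] assms
    by (auto simp: closed_curve_on_def reversepath_def[abs_def] bounded_linear_ident)
qed

lemma surface_cross_uminus [simp]:
  "surface_cross \<nu> p (- v) (- w) = surface_cross \<nu> p v w"
  "surface_cross (\<lambda>p. - \<nu> p) p v w = - surface_cross \<nu> p v w"
  by (auto simp: surface_cross_def cross3_simps)

text \<open>
  Time reversal on the circle, with fundamental domain \<open>{0..<1}\<close>; the basepoint \<open>0\<close> is fixed, whereas
  \<open>1 - 0\<close> would leave the domain.
\<close>

definition reverse_time :: "real \<Rightarrow> real" where "reverse_time s = (if s = 0 then 0 else 1 - s)"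

lemma reversepath_reverse_time:
  "closed_curve_on S c \<Longrightarrow> reversepath c (reverse_time s) = c s \<and> velocity (reversepath c) (reverse_time s) = - velocity c s"
proof -
  assume c: "closed_curve_on S c"
  have "c (t + 1) = c t" for t using c by (simp add: closed_curve_on_def)
  from this this[of 0] have *: "(\<lambda>t. c (1 * t + 1)) = c" "c 1 = c 0" by simp_all
  have "velocity c 1 = velocity c 0"
    using velocity_affine_linear[of "\<lambda>x. x" c 1 1 0] c
    unfolding *(1) by (simp add: bounded_linear_ident closed_curve_on_def)
  then show ?thesis using * c
    by (auto simp: velocity_reversepath closed_curve_on_def reverse_time_def) (auto simp: reversepath_def)
qed

lemma intersections_reversepath:
  assumes "closed_curve_on S p" "closed_curve_on S q"
  shows "bij_betw (map_prod reverse_time reverse_time) (intersections p q) (intersections (reversepath p) (reversepath q))"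
proof (rule bij_betw_byWitness[where f' = "map_prod reverse_time reverse_time"])
  have r: "reverse_time (reverse_time s) = s" "reverse_time s \<in> {0..<1}" if "s \<in> {0..<1}" for s
    using that by (auto simp: reverse_time_def)
  have "p (reverse_time s) = reversepath p s" "q (reverse_time s) = reversepath q s" if "s \<in> {0..<1}" for s
    using reversepath_reverse_time[OF assms(1), of "reverse_time s"] reversepath_reverse_time[OF assms(2), of "reverse_time s"]
    by (simp_all add: r(1)[OF that])
  then show "map_prod reverse_time reverse_time ` intersections (reversepath p) (reversepath q) \<subseteq> intersections p q"
    using r(2) by (auto simp: intersections_def)
  show "map_prod reverse_time reverse_time ` intersections p q \<subseteq> intersections (reversepath p) (reversepath q)"
  proof (rule image_subsetI)
    fix x assume "x \<in> intersections p q"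
    then obtain s t where st: "x = (s, t)" "s \<in> {0..<1}" "t \<in> {0..<1}" "p s = q t"
      unfolding intersections_def by blast
    then have "reversepath p (reverse_time s) = reversepath q (reverse_time t)"
      using reversepath_reverse_time[OF assms(1)] reversepath_reverse_time[OF assms(2)] by simp
    then show "map_prod reverse_time reverse_time x \<in> intersections (reversepath p) (reversepath q)"
      using st r(2)[OF st(2)] r(2)[OF st(3)] by (simp add: intersections_def)
  qed
  have "map_prod reverse_time reverse_time (map_prod reverse_time reverse_time x) = x" if "x \<in> intersections p' q'"
    for p' q' :: "real \<Rightarrow> real ^ 3" and x
    using that r(1)[of "fst x"] r(1)[of "snd x"] by (cases x) (simp add: intersections_def)
  then show "\<forall>x\<in>intersections p q. map_prod reverse_time reverse_time (map_prod reverse_time reverse_time x) = x"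
    "\<forall>x\<in>intersections (reversepath p) (reversepath q).
       map_prod reverse_time reverse_time (map_prod reverse_time reverse_time x) = x"
    by blast+
qed

lemma
  assumes "closed_curve_on S p" "closed_curve_on S q"
  shows transverse_reversepath: "transverse \<nu> p q \<Longrightarrow> transverse \<nu> (reversepath p) (reversepath q)"
    and signed_count_reversepath: "signed_count \<nu> (reversepath p) (reversepath q) = signed_count \<nu> p q"
proof -
  note bij = intersections_reversepath[OF assms]
  show "signed_count \<nu> (reversepath p) (reversepath q) = signed_count \<nu> p q"
    unfolding signed_count_def
    by (subst sum.reindex_bij_betw[OF bij, symmetric])
      (simp add: case_prod_beta reversepath_reverse_time[OF assms(1)] reversepath_reverse_time[OF assms(2)])
  show "transverse \<nu> (reversepath p) (reversepath q)" if "transverse \<nu> p q"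
    using that unfolding transverse_def bij_betw_imp_surj_on[OF bij, symmetric]
    by (auto simp: case_prod_beta reversepath_reverse_time[OF assms(1)] reversepath_reverse_time[OF assms(2)])
qed

text \<open>
  Reversing both curves negates both velocities at each intersection point, and hence preserves its
  sign; moreover reversal preserves free homotopy.
\<close>

lemma intersection_number_reversepath:
  "intersection_number S \<nu> (reversepath p) (reversepath q) = intersection_number S \<nu> p q"
proof -
  define P where "P p q n \<longleftrightarrow> (\<exists>p' q'. closed_curve_on S p' \<and> closed_curve_on S q' \<and>
     homotopic_loops S p p' \<and> homotopic_loops S q q' \<and>
     transverse \<nu> p' q' \<and> n = signed_count \<nu> p' q')" for p q n
  have rev: "P (reversepath p) (reversepath q) n" if "P p q n" for p q n
  proof -
    from that obtain p' q' where "closed_curve_on S p'" "closed_curve_on S q'"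
        "homotopic_loops S p p'" "homotopic_loops S q q'" "transverse \<nu> p' q'"
        "n = signed_count \<nu> p' q'" unfolding P_def by blast
    then show ?thesis unfolding P_def
      by (intro exI[of _ "reversepath p'"] exI[of _ "reversepath q'"])
        (simp add: closed_curve_on_reversepath homotopic_loops_reversepath
          transverse_reversepath signed_count_reversepath)
  qed
  have "P (reversepath p) (reversepath q) = P p q"
    using rev[of p q] rev[of "reversepath p" "reversepath q"] by (auto simp: fun_eq_iff)
  then show ?thesis unfolding intersection_number_def P_def by simp
qed

lemma intersection_number_opposite_orientation:
  "intersection_number S (\<lambda>p. - \<nu> p) p q = - intersection_number S \<nu> p q"
proof -
  have "transverse (\<lambda>p. - \<nu> p) p q \<longleftrightarrow> transverse \<nu> p q"
       "signed_count (\<lambda>p. - \<nu> p) p q = - signed_count \<nu> p q" for p q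
    by (auto simp: transverse_def signed_count_def case_prod_beta floor_minus_sgn sum_negf)
  then show ?thesis unfolding intersection_number_def
    by (intro common_value_image) auto
qed

section \<open>Laurent polynomials under inversion of the variable\<close>

text \<open>
  For \<open>\<kappa> = 1\<close> and \<open>\<kappa> = - 1\<close>, this substitutes the \<open>\<kappa>\<close>-th power of \<open>t\<close> for \<open>t\<close>; since then \<open>\<kappa>\<close> is its
  own inverse, the coefficient at \<open>k\<close> is that of \<open>p\<close> at \<open>\<kappa> * k\<close>.
\<close>

definition subst_power :: "int \<Rightarrow> laurent \<Rightarrow> laurent" where
  "subst_power \<kappa> p = Poly_Mapping.map_key ((*) \<kappa>) p"

lemma subst_inverse_eq: "subst_inverse = subst_power (- 1)"
  unfolding subst_inverse_def subst_power_def by (intro ext arg_cong2[where f = Poly_Mapping.map_key]) auto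

lemma subst_power_one [simp]: "subst_power 1 p = p"
proof -
  have "((*) 1 :: int \<Rightarrow> int) = (\<lambda>k. k)" by auto
  then show ?thesis by (simp only: subst_power_def map_key_id)
qed

lemma inj_mult_sign: "\<kappa> \<in> {1, - 1} \<Longrightarrow> inj ((*) (\<kappa> :: int))"
  by (auto simp: inj_on_def)

lemma
  assumes \<kappa>: "\<kappa> \<in> {1, - 1}"
  shows subst_power_0: "subst_power \<kappa> 0 = 0"
    and subst_power_plus: "subst_power \<kappa> (p + q) = subst_power \<kappa> p + subst_power \<kappa> q"
    and subst_power_t_pow: "subst_power \<kappa> (t_pow k) = t_pow (\<kappa> * k)"
    and subst_power_subst_power: "subst_power \<kappa> (subst_power \<kappa> p) = p"
proof -
  note inj = inj_mult_sign[OF \<kappa>]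
  show "subst_power \<kappa> 0 = 0" "subst_power \<kappa> (p + q) = subst_power \<kappa> p + subst_power \<kappa> q"
    by (simp_all add: subst_power_def map_key_plus[OF inj] map_key_zero[OF inj])
  have "\<kappa> * (\<kappa> * k) = k" for k using \<kappa> by auto
  then show "subst_power \<kappa> (t_pow k) = t_pow (\<kappa> * k)"
    using map_key_single[OF inj, of "\<kappa> * k" 1] by (simp only: subst_power_def t_pow_def)
  show "subst_power \<kappa> (subst_power \<kappa> p) = p"
    unfolding subst_power_def using \<kappa>
    by (subst map_key_compose) (auto simp: inj o_def map_key_id)
qed

lemma subst_power_1: "\<kappa> \<in> {1, - 1} \<Longrightarrow> subst_power \<kappa> 1 = 1"
  using subst_power_t_pow[of \<kappa> 0] by (simp add: t_pow_def)

lemma subst_power_diff: "\<kappa> \<in> {1, - 1} \<Longrightarrow> subst_power \<kappa> (p - q) = subst_power \<kappa> p - subst_power \<kappa> q"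
  using subst_power_plus[of \<kappa> "p - q" q] by simp

lemma subst_power_of_int_mult:
  assumes \<kappa>: "\<kappa> \<in> {1, - 1}"
  shows "subst_power \<kappa> (of_int c * p) = of_int c * subst_power \<kappa> p"
proof -
  have nat: "subst_power \<kappa> (of_nat n * p) = of_nat n * subst_power \<kappa> p" for n
    by (induction n) (simp_all add: distrib_right subst_power_0[OF \<kappa>] subst_power_plus[OF \<kappa>])
  show ?thesis
  proof (cases c rule: int_cases2)
    case (nonneg n)
    then show ?thesis using nat by simp
  next
    case (nonpos n)
    then show ?thesis using nat[of n] subst_power_diff[OF \<kappa>, of 0 "of_nat n * p"] by (simp add: subst_power_0[OF \<kappa>])
  qed
qed

lemma subst_power_sum:
  "\<kappa> \<in> {1, - 1} \<Longrightarrow> subst_power \<kappa> (\<Sum>i\<in>A. f i) = (\<Sum>i\<in>A. subst_power \<kappa> (f i))"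
  by (induction A rule: infinite_finite_induct) (simp_all add: subst_power_0 subst_power_plus)

lemma inj_subst_power: "\<kappa> \<in> {1, - 1} \<Longrightarrow> inj (subst_power \<kappa>)"
  by (rule inj_on_inverseI[of _ "subst_power \<kappa>"]) (rule subst_power_subst_power)

section \<open>Symmetries of the plane acting on diagrams\<close>

text \<open>
  Reversing the direction of \<open>A\<close>, or relabelling the strands, turns the strict comparisons of the crossings
  of \<open>A\<close> with \<open>B\<close> and with \<open>C\<close> around. The condition survives this because there are no triple points,
  so that the parameters compared are different.
\<close>

lemma order_reversed_swap:
  assumes "long_virtual_diagram D" and "long_virtual_diagram D'"
    and "A \<inter> B = {}" and "A \<inter> C = {}" and "B \<inter> C = {}" and "order_reversed D D' A B C"
  shows "order_reversed D D' A C B"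
proof -
  have ne: "s \<noteq> t" if E: "long_virtual_diagram E" "s \<in> crossing_params E A B" "t \<in> crossing_params E A C"
    for E s t
  proof
    assume "s = t"
    obtain b where b: "s \<in> A" "b \<in> B" "curve E s = curve E b"
      using E(2) by (auto simp: crossing_params_def)
    obtain c where c: "c \<in> C" "curve E s = curve E c"
      using E(3) \<open>s = t\<close> by (auto simp: crossing_params_def)
    then have "(s, b) \<in> double_points (curve E)" "(s, c) \<in> double_points (curve E)"
      using assms(3,4) b c by (auto simp: double_points_def)
    then have "b = c"
      using E(1) unfolding long_virtual_diagram_def by blast
    then show False using b c assms(5) by blast
  qed
  show ?thesis
    unfolding order_reversed_def
  proof (intro ballI)
    fix s t s' t'
    assume *: "s \<in> crossing_params D A C" "t \<in> crossing_params D A B"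
      "s' \<in> crossing_params D' A C" "t' \<in> crossing_params D' A B"
    then have "t < s \<longleftrightarrow> s' < t'"
      using assms(6) by (simp add: order_reversed_def)
    then show "s < t \<longleftrightarrow> t' < s'"
      using ne[OF assms(1) *(2,1)] ne[OF assms(2) *(4,3)] by auto
  qed
qed

text \<open>
  The data common to reversal and mirror image: a linear isometric involution \<open>g\<close> of the plane and
  a sign \<open>e\<close> by which the parameter is multiplied, which compensates the effect of \<open>g\<close> on the real axis.
  The sign \<open>\<delta>\<close> says whether \<open>g\<close> preserves the orientation of the plane.
\<close>

locale plane_symmetry =
  fixes g :: "complex \<Rightarrow> complex" and e :: real and \<delta> :: int
  assumes bounded_linear: "bounded_linear g"
    and norm: "\<And>z. norm (g z) = norm z"
    and involution: "\<And>z. g (g z) = z"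
    and e: "e \<in> {1, - 1}"
    and real_axis: "\<And>x. g (of_real x) = of_real (e * x)"
    and planar_cross: "\<And>v w. planar_cross (g v) (g w) = of_int \<delta> * planar_cross v w"
    and \<delta>: "\<delta> \<in> {1, - 1}"
begin

definition transform :: "diagram \<Rightarrow> diagram" where
  "transform D = \<lparr>curve = (\<lambda>t. g (curve D (e * t))),
                  real_crossings = map_prod ((*) e) ((*) e) -` real_crossings D\<rparr>"

abbreviation m :: "real \<Rightarrow> real" where "m \<equiv> (*) e"
abbreviation m2 :: "real \<times> real \<Rightarrow> real \<times> real" where "m2 \<equiv> map_prod m m"

lemma e_e [simp]: "e * (e * t) = t" and e_square [simp]: "e * e = 1" and e_nonzero [simp]: "e \<noteq> 0"
  using e by auto

lemma g_eq_iff [simp]: "g z = g w \<longleftrightarrow> z = w"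
  by (metis involution)

lemma e_eq_iff [simp]: "e * s = e * t \<longleftrightarrow> s = t"
  using e by auto

lemma m_m2_involution [simp]: "m \<circ> m = id" "m2 \<circ> m2 = id"
  by (auto simp: fun_eq_iff)

lemma bij_m: "bij m" and bij_m2: "bij m2"
  by (auto intro: o_bij m_m2_involution)

lemma m2_vimage_Times: "m2 -` (A \<times> B) = m -` A \<times> m -` B"
  by auto

lemma vimage_eq_iff: "m2 -` P = m2 -` Q \<longleftrightarrow> P = Q" "m -` A = m -` B \<longleftrightarrow> A = B"
  by (metis bij_m2 bij_is_surj surj_image_vimage_eq) (metis bij_m bij_is_surj surj_image_vimage_eq)

lemma transform_sel:
  "curve (transform D) = (\<lambda>t. g (curve D (e * t)))"
  "real_crossings (transform D) = m2 -` real_crossings D"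
  by (simp_all add: transform_def)

lemma transform_transform [simp]: "transform (transform D) = D"
  by (auto simp: transform_def involution vimage_comp simp del: e_square)

lemma double_points_transform: "double_points (curve (transform D)) = m2 -` double_points (curve D)"
  by (auto simp: double_points_def transform_sel)

lemma g_zero_iff: "g z = 0 \<longleftrightarrow> z = 0"
  by (metis norm norm_eq_zero)

lemma velocity_transform:
  assumes "long_virtual_diagram D"
  shows "velocity (curve (transform D)) t = e *\<^sub>R g (velocity (curve D) (e * t))"
  using velocity_affine_linear[OF bounded_linear, of "curve D" e 0 t] assms
  by (simp add: transform_sel long_virtual_diagram_def immersion_def)

lemma planar_cross_scaleR: "planar_cross (e *\<^sub>R v) (e *\<^sub>R w) = planar_cross v w"
  using e by (auto simp: planar_cross_def)

lemma planar_cross_transform: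
  assumes "long_virtual_diagram D"
  shows "planar_cross (velocity (curve (transform D)) s) (velocity (curve (transform D)) t) =
    of_int \<delta> * planar_cross (velocity (curve D) (e * s)) (velocity (curve D) (e * t))"
  by (simp add: velocity_transform[OF assms] planar_cross_scaleR planar_cross)

lemma long_virtual_diagram_transform:
  assumes "long_virtual_diagram D"
  shows "long_virtual_diagram (transform D)"
proof -
  note D = assms[unfolded long_virtual_diagram_def]
  have "immersion (curve (transform D))"
    using immersion_affine_linear[OF bounded_linear, of e "curve D" 0] D e
    by (auto simp: transform_sel g_zero_iff)
  moreover obtain r where r: "\<And>t. \<bar>t\<bar> \<ge> r \<Longrightarrow> curve D t = of_real t" using D by blast
  have "\<bar>e * t\<bar> = \<bar>t\<bar>" for t using e by auto
  then have "\<exists>r. \<forall>t. \<bar>t\<bar> \<ge> r \<longrightarrow> curve (transform D) t = of_real t"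
    using r by (intro exI[of _ r]) (simp add: transform_sel real_axis del: of_real_mult)
  moreover have "finite (m2 -` double_points (curve D))"
    using D bij_is_inj[OF bij_m2] by (intro finite_vimageI) auto
  moreover have "\<forall>(s, t) \<in> m2 -` double_points (curve D).
      planar_cross (velocity (curve (transform D)) s) (velocity (curve (transform D)) t) \<noteq> 0"
    using D \<delta> by (auto simp: planar_cross_transform[OF assms])
  moreover have "\<forall>r s t. (r, s) \<in> m2 -` double_points (curve D) \<and> (r, t) \<in> m2 -` double_points (curve D) \<longrightarrow> s = t"
    using D by (metis e_eq_iff map_prod_simp vimage_eq)
  moreover have "m2 -` real_crossings D \<subseteq> m2 -` double_points (curve D)"
    using D by auto
  moreover have "\<forall>x y. (x, y) \<in> m2 -` real_crossings D \<longrightarrow> (y, x) \<notin> m2 -` real_crossings D"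
    using D by auto
  ultimately show ?thesis
    unfolding long_virtual_diagram_def double_points_transform transform_sel(2) by blast
qed

lemma crossing_sign_transform:
  assumes "long_virtual_diagram D"
  shows "crossing_sign (transform D) i = \<delta> * crossing_sign D (m2 i)"
  using \<delta> by (auto simp: crossing_sign_def case_prod_beta planar_cross_transform[OF assms] floor_minus_sgn)

lemma planar_isotopic_transform:
  assumes "planar_isotopic D D'"
  shows "planar_isotopic (transform D) (transform D')"
proof -
  obtain h k \<phi> where h: "homeomorphism UNIV UNIV h k" "bounded {z. h z \<noteq> z}"
    "strict_mono \<phi>" "surj \<phi>" "curve D' = h \<circ> curve D \<circ> \<phi>"
    "real_crossings D' = {(x, y). (\<phi> x, \<phi> y) \<in> real_crossings D}"
    using assms unfolding planar_isotopic_def by blast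
  have g: "homeomorphism UNIV UNIV g g"
    using bounded_linear involution
    by (auto simp: homeomorphism_def linear_continuous_on intro!: surjI[of g g])
  show ?thesis unfolding planar_isotopic_def
  proof (intro exI conjI)
    show "homeomorphism UNIV UNIV (g \<circ> (h \<circ> g)) ((g \<circ> k) \<circ> g)"
      by (intro homeomorphism_compose[OF _ g] homeomorphism_compose[OF g] h)
    have "{z. (g \<circ> (h \<circ> g)) z \<noteq> z} \<subseteq> g ` {z. h z \<noteq> z}"
      by (auto simp: image_iff) (metis involution)
    then show "bounded {z. (g \<circ> (h \<circ> g)) z \<noteq> z}"
      using bounded_linear_image[OF h(2) bounded_linear] bounded_subset by blast
    show "strict_mono (m \<circ> \<phi> \<circ> m)"
      using h(3) e by (auto simp: strict_mono_def)
    show "surj (m \<circ> \<phi> \<circ> m)"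
      by (intro comp_surj h(4) bij_is_surj bij_m)
    show "curve (transform D') = g \<circ> (h \<circ> g) \<circ> curve (transform D) \<circ> (m \<circ> \<phi> \<circ> m)"
      by (auto simp: transform_sel h(5) involution)
    show "real_crossings (transform D') =
        {(x, y). ((m \<circ> \<phi> \<circ> m) x, (m \<circ> \<phi> \<circ> m) y) \<in> real_crossings (transform D)}"
      by (auto simp: transform_sel h(6))
  qed
qed

lemma strand_transform: "strand A \<Longrightarrow> strand (m -` A)"
proof -
  assume "strand A"
  then obtain a b where ab: "a < b" "A = {a..b}" by (auto simp: strand_def)
  show ?thesis
  proof (cases "e = 1")
    case True
    then have "m -` A = A" by auto
    then show ?thesis using \<open>strand A\<close> by simp
  next
    case False
    then have "m -` A = {- b..- a}" using ab e by auto
    then show ?thesis using ab unfolding strand_def by (intro exI[of _ "- b"] exI[of _ "- a"]) auto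
  qed
qed

lemma differ_in_disk_transform:
  assumes "differ_in_disk T D D'"
  shows "differ_in_disk (m -` T) (transform D) (transform D')"
proof -
  obtain z r where zr: "r > 0" "curve D -` cball z r = T" "curve D' -` cball z r = T"
    using assms by (auto simp: differ_in_disk_def)
  have "dist (g z) (g w) = dist z w" for w
    by (metis bounded_linear linear_simps(2) norm dist_norm)
  then have "curve (transform E) -` cball (g z) r = m -` (curve E -` cball z r)" for E
    by (auto simp: transform_sel)
  then have "\<exists>z r. r > 0 \<and> curve (transform D) -` cball z r = m -` T \<and> curve (transform D') -` cball z r = m -` T"
    using zr by metis
  moreover have "\<forall>t. t \<notin> m -` T \<longrightarrow> curve (transform D) t = curve (transform D') t"
    using assms by (auto simp: differ_in_disk_def transform_sel)
  moreover have "real_crossings (transform D) - m -` T \<times> m -` T = real_crossings (transform D') - m -` T \<times> m -` T"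
    using assms unfolding transform_sel m2_vimage_Times[symmetric] vimage_Diff[symmetric]
    by (simp add: differ_in_disk_def)
  ultimately show ?thesis unfolding differ_in_disk_def by blast
qed

lemma m2_vimage_crossing: "m2 -` {(s, t), (t, s)} = {(e * s, e * t), (e * t, e * s)}"
proof -
  have "e * a = s \<longleftrightarrow> a = e * s" for a s
    by auto
  then show ?thesis by auto
qed

lemma vimage_empty_iff: "m2 -` P = {} \<longleftrightarrow> P = {}" "m -` A = {} \<longleftrightarrow> A = {}"
  using vimage_eq_iff(1)[of P "{}"] vimage_eq_iff(2)[of A "{}"] by auto

lemma card_m2_vimage: "card (m2 -` P) = card P"
  using bij_m2 by (intro card_vimage_inj) (auto simp: bij_is_inj bij_is_surj)

lemmas vimage_fold = transform_sel(2) double_points_transform vimage_Un[symmetric]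
  m2_vimage_Times[symmetric] vimage_Int[symmetric] vimage_empty_iff vimage_eq_iff card_m2_vimage

text \<open>
  In each move, the conditions on crossings are equations between sets of parameters or of pairs of
  parameters, and statements on their cardinality. For the transformed diagrams the sets are replaced by their
  preimages under the bijections \<open>m\<close> and \<open>m2\<close>, and taking preimages commutes with all set operations involved.
\<close>

lemma move_I_transform:
  assumes "move_I D D'"
  shows "move_I (transform D) (transform D')"
proof -
  obtain A s t where A: "strand A" "differ_in_disk A D D'" "double_points (curve D) \<inter> A \<times> A = {}"
    "s \<noteq> t" "double_points (curve D') \<inter> A \<times> A = {(s, t), (t, s)}"
    using assms unfolding move_I_def by blast
  show ?thesis unfolding move_I_def
  proof (rule exI[of _ "m -` A"], intro conjI, goal_cases)
    case 4
    show ?case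
      by (rule exI[of _ "e * s"], rule exI[of _ "e * t"])
        (simp only: A vimage_fold m2_vimage_crossing[symmetric] e_eq_iff simp_thms)
  qed (simp_all only: A strand_transform differ_in_disk_transform vimage_fold)
qed

lemma move_II_transform:
  assumes "move_II D D'"
  shows "move_II (transform D) (transform D')"
proof -
  obtain A B where *: "strand A" "strand B" "A \<inter> B = {}" "differ_in_disk (A \<union> B) D D'"
    "double_points (curve D) \<inter> (A \<union> B) \<times> (A \<union> B) = {}"
    "double_points (curve D') \<inter> (A \<times> A \<union> B \<times> B) = {}"
    "card (double_points (curve D') \<inter> A \<times> B) = 2"
    "real_crossings D' \<inter> (A \<union> B) \<times> (A \<union> B) \<in> {{}, double_points (curve D') \<inter> A \<times> B}"
    using assms unfolding move_II_def by blast
  show ?thesis unfolding move_II_def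
  proof (rule exI[of _ "m -` A"], rule exI[of _ "m -` B"], intro conjI)
  qed (use * in \<open>simp_all only: strand_transform differ_in_disk_transform vimage_fold insert_iff empty_iff\<close>)
qed

lemma crossing_params_transform:
  "crossing_params (transform D) (m -` A) (m -` B) = m -` crossing_params D A B"
proof -
  have "(\<exists>t\<in>m -` B. curve D s = curve D (e * t)) \<longleftrightarrow> (\<exists>t\<in>B. curve D s = curve D t)" for s
    by (metis e_e vimage_eq)
  then show ?thesis by (auto simp: crossing_params_def transform_sel)
qed

lemma order_reversed_transform:
  assumes "long_virtual_diagram D" and "long_virtual_diagram D'"
    and "A \<inter> B = {}" and "A \<inter> C = {}" and "B \<inter> C = {}" and "order_reversed D D' A B C"
  shows "order_reversed (transform D) (transform D') (m -` A) (m -` B) (m -` C)"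
proof (cases "e = 1")
  case True
  then show ?thesis using assms(6)
    unfolding order_reversed_def crossing_params_transform by simp
next
  case False
  then have "e = - 1" using e by simp
  then show ?thesis using assms(6) order_reversed_swap[OF assms]
    unfolding order_reversed_def crossing_params_transform
    by (metis mult_minus1 neg_less_iff_less vimage_eq)
qed

lemma pairwise_crossing_once_transform:
  "pairwise_crossing_once D A B C \<Longrightarrow>
   pairwise_crossing_once (transform D) (m -` A) (m -` B) (m -` C)"
  unfolding pairwise_crossing_once_def by (simp only: vimage_fold)

lemma move_III_transform:
  assumes "long_virtual_diagram D" and "long_virtual_diagram D'" and "move_III D D'"
  shows "move_III (transform D) (transform D')"
proof -
  obtain A B C P where *: "strand A" "strand B" "strand C" "A \<inter> B = {}" "A \<inter> C = {}" "B \<inter> C = {}"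
    "differ_in_disk (A \<union> B \<union> C) D D'" "pairwise_crossing_once D A B C" "pairwise_crossing_once D' A B C"
    "order_reversed D D' A B C" "order_reversed D D' B A C" "order_reversed D D' C A B"
    "P \<in> {A \<times> B \<union> A \<times> C \<union> B \<times> C, {}, A \<times> B}"
    "\<forall>E \<in> {D, D'}. real_crossings E \<inter> (A \<union> B \<union> C) \<times> (A \<union> B \<union> C) = double_points (curve E) \<inter> P"
    using assms unfolding move_III_def by blast
  have disj: "B \<inter> A = {}" "C \<inter> A = {}" "C \<inter> B = {}" using * by auto
  let ?A = "m -` A" and ?B = "m -` B" and ?C = "m -` C"
  have P: "m2 -` P \<in> {?A \<times> ?B \<union> ?A \<times> ?C \<union> ?B \<times> ?C, {}, ?A \<times> ?B}"
    using *(13) by auto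
  have crossings: "\<forall>E \<in> {transform D, transform D'}.
      real_crossings E \<inter> (?A \<union> ?B \<union> ?C) \<times> (?A \<union> ?B \<union> ?C) = double_points (curve E) \<inter> m2 -` P"
    using *(14) by (simp only: vimage_fold ball_simps)
  have disjoint: "?A \<inter> ?B = {}" "?A \<inter> ?C = {}" "?B \<inter> ?C = {}"
    using * by (simp_all only: vimage_fold)
  have disk: "differ_in_disk (?A \<union> ?B \<union> ?C) (transform D) (transform D')"
    using differ_in_disk_transform[OF *(7)] by (simp only: vimage_Un)
  note orders = order_reversed_transform[OF assms(1,2) *(4-6,10)]
    order_reversed_transform[OF assms(1,2) disj(1) *(6,5,11)]
    order_reversed_transform[OF assms(1,2) disj(2,3) *(4,12)]
  note strands = *(1-3)[THEN strand_transform] *(8,9)[THEN pairwise_crossing_once_transform]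
  show ?thesis unfolding move_III_def
  proof (rule exI[of _ ?A], rule exI[of _ ?B], rule exI[of _ ?C], intro conjI bexI[of _ "m2 -` P"])
  qed (rule P crossings disjoint disk orders strands)+
qed

lemma move_transform: "move D D' \<Longrightarrow> move (transform D) (transform D')"
  unfolding move_def
  using long_virtual_diagram_transform planar_isotopic_transform move_I_transform move_II_transform
    move_III_transform by blast

end

interpretation half_turn: plane_symmetry uminus "- 1" 1
  by (rule plane_symmetry.intro, rule bounded_linear_minus[OF bounded_linear_ident])
    (auto simp: planar_cross_def)

interpretation reflection: plane_symmetry cnj 1 "- 1"
  by (rule plane_symmetry.intro, rule bounded_linear_cnj) (auto simp: planar_cross_def)

lemma reverse_eq_transform: "reverse = half_turn.transform"
  by (auto simp: fun_eq_iff reverse_def half_turn.transform_def)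

lemma mirror_eq_transform: "mirror = reflection.transform"
proof (rule ext)
  fix D
  show "mirror D = reflection.transform D"
    by (cases D) (auto simp: mirror_def reflection.transform_def)
qed

section \<open>Switching crossings of diagrams\<close>

lemma switch_sel [simp]:
  "curve (switch D) = curve D" "real_crossings (switch D) = (real_crossings D)\<inverse>"
  by (simp_all add: switch_def)

lemma switch_switch [simp]: "switch (switch D) = D"
  by (simp add: switch_def)

lemma converse_double_points [simp]: "(double_points c)\<inverse> = double_points c"
  by (auto simp: double_points_def)

lemma long_virtual_diagram_switch:
  assumes "long_virtual_diagram D"
  shows "long_virtual_diagram (switch D)"
proof -
  have "real_crossings D \<subseteq> double_points (curve D)"
    using assms unfolding long_virtual_diagram_def by (elim conjE)
  then have subset: "(real_crossings D)\<inverse> \<subseteq> double_points (curve D)"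
    by (metis converse_double_points converse_mono)
  have "\<forall>x y. (x, y) \<in> real_crossings D \<longrightarrow> (y, x) \<notin> real_crossings D"
    using assms unfolding long_virtual_diagram_def by (elim conjE)
  then have "\<forall>x y. (x, y) \<in> (real_crossings D)\<inverse> \<longrightarrow> (y, x) \<notin> (real_crossings D)\<inverse>"
    by simp
  with assms subset show ?thesis
    unfolding long_virtual_diagram_def switch_sel by (elim conjE) (intro conjI; assumption)
qed

lemma differ_in_disk_switch: "differ_in_disk T D D' \<Longrightarrow> differ_in_disk T (switch D) (switch D')"
  unfolding differ_in_disk_def switch_sel by blast

lemma converse_Int_Times: "R\<inverse> \<inter> T \<times> T = (R \<inter> T \<times> T)\<inverse>"
  "(double_points c \<inter> P)\<inverse> = double_points c \<inter> P\<inverse>"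
  by (auto simp: double_points_def)

lemma card_crossings_commute:
  "card (double_points c \<inter> B \<times> A) = card (double_points c \<inter> A \<times> B)"
proof -
  have "double_points c \<inter> B \<times> A = (double_points c \<inter> A \<times> B)\<inverse>"
    by (simp add: converse_Int_Times converse_Times)
  then show ?thesis by (simp add: card_inverse)
qed

lemma pairwise_crossing_once_permute:
  assumes "pairwise_crossing_once D A B C"
  shows "pairwise_crossing_once D B A C" "pairwise_crossing_once D C B A"
  using assms by (auto simp: pairwise_crossing_once_def card_crossings_commute Un_ac)

lemma local_conditions_switch:
  "order_reversed (switch D) (switch D') A B C \<longleftrightarrow> order_reversed D D' A B C"
  "pairwise_crossing_once (switch D) A B C \<longleftrightarrow> pairwise_crossing_once D A B C"
  by (simp_all add: order_reversed_def crossing_params_def pairwise_crossing_once_def)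

text \<open>
  After switching, \<open>B\<close> passes over \<open>A\<close>, so the two strands exchange their roles.
\<close>

lemma move_II_switch:
  assumes "move_II D D'"
  shows "move_II (switch D) (switch D')"
proof -
  obtain A B where *: "strand A" "strand B" "A \<inter> B = {}" "differ_in_disk (A \<union> B) D D'"
    "double_points (curve D) \<inter> (A \<union> B) \<times> (A \<union> B) = {}"
    "double_points (curve D') \<inter> (A \<times> A \<union> B \<times> B) = {}"
    "card (double_points (curve D') \<inter> A \<times> B) = 2"
    "real_crossings D' \<inter> (A \<union> B) \<times> (A \<union> B) \<in> {{}, double_points (curve D') \<inter> A \<times> B}"
    using assms unfolding move_II_def by (elim exE conjE)
  have comm: "B \<union> A = A \<union> B" "B \<inter> A = A \<inter> B" "B \<times> B \<union> A \<times> A = A \<times> A \<union> B \<times> B" by blast+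
  have "(double_points (curve D') \<inter> A \<times> B)\<inverse> = double_points (curve D') \<inter> B \<times> A"
    by (simp add: converse_Int_Times converse_Times)
  then have "real_crossings (switch D') \<inter> (B \<union> A) \<times> (B \<union> A) \<in> {{}, double_points (curve D') \<inter> B \<times> A}"
    using *(8) unfolding switch_sel converse_Int_Times(1) comm by (elim insertE emptyE) simp_all
  note crossings = this
  show ?thesis unfolding move_II_def
  proof (rule exI[of _ B], rule exI[of _ A], intro conjI)
  qed (use crossings * differ_in_disk_switch[OF *(4)] in
      \<open>simp_all only: switch_sel comm card_crossings_commute\<close>)
qed

text \<open>
  Switching turns the stack of three strands upside down. In the classical move \<open>A\<close> and \<open>C\<close> therefore
  exchange their roles; in the mixed move only the real crossing of \<open>A\<close> and \<open>B\<close> is switched, so \<open>A\<close> and \<open>B\<close> do.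
\<close>

lemma move_III_switch:
  assumes "long_virtual_diagram D" and "long_virtual_diagram D'" and "move_III D D'"
  shows "move_III (switch D) (switch D')"
proof -
  obtain A B C P where *: "strand A" "strand B" "strand C" "A \<inter> B = {}" "A \<inter> C = {}" "B \<inter> C = {}"
    "differ_in_disk (A \<union> B \<union> C) D D'" "pairwise_crossing_once D A B C" "pairwise_crossing_once D' A B C"
    "order_reversed D D' A B C" "order_reversed D D' B A C" "order_reversed D D' C A B"
    "P \<in> {A \<times> B \<union> A \<times> C \<union> B \<times> C, {}, A \<times> B}"
    "\<forall>E \<in> {D, D'}. real_crossings E \<inter> (A \<union> B \<union> C) \<times> (A \<union> B \<union> C) = double_points (curve E) \<inter> P"
    using assms unfolding move_III_def by blast
  have disj: "B \<inter> A = {}" "C \<inter> A = {}" "C \<inter> B = {}" using * by auto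
  have crossings: "\<forall>E \<in> {switch D, switch D'}. real_crossings E \<inter> (A \<union> B \<union> C) \<times> (A \<union> B \<union> C)
      = double_points (curve E) \<inter> P\<inverse>"
    using *(14) by (simp add: converse_Int_Times)
  note disk = differ_in_disk_switch[OF *(7)]
  note swap = order_reversed_swap[OF assms(1,2)]
  have orders: "order_reversed D D' C B A" "order_reversed D D' B C A" "order_reversed D D' A C B"
    by (rule swap[OF disj(2,3) *(4) *(12)], rule swap[OF disj(1) *(6,5) *(11)],
        rule swap[OF *(4-6) *(10)])
  note pairwise = pairwise_crossing_once_permute[OF *(8)] pairwise_crossing_once_permute[OF *(9)]
  show ?thesis
  proof (cases "P = A \<times> B")
    case True
    have union: "B \<union> A \<union> C = A \<union> B \<union> C" by blast
    have P: "P\<inverse> \<in> {B \<times> A \<union> B \<times> C \<union> A \<times> C, {}, B \<times> A}"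
      unfolding True by (simp add: converse_Times)
    show ?thesis unfolding move_III_def
    proof (rule exI[of _ B], rule exI[of _ A], rule exI[of _ C], intro conjI bexI[of _ "P\<inverse>"])
    qed (simp_all only: local_conditions_switch union,
        (rule *(1-6,8-12) disj disk crossings orders pairwise P)+)
  next
    case False
    \<comment> \<open>All crossings are real or all are virtual.\<close>
    then have P: "P\<inverse> \<in> {C \<times> B \<union> C \<times> A \<union> B \<times> A, {}, C \<times> B}"
      using *(13) by auto
    have union: "C \<union> B \<union> A = A \<union> B \<union> C" by blast
    show ?thesis unfolding move_III_def
    proof (rule exI[of _ C], rule exI[of _ B], rule exI[of _ A], intro conjI bexI[of _ "P\<inverse>"])
    qed (simp_all only: local_conditions_switch union,
        (rule *(1-6,8-12) disj disk crossings orders pairwise P)+)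
  qed
qed

lemma move_switch: "move D D' \<Longrightarrow> move (switch D) (switch D')"
proof -
  have "planar_isotopic D D' \<Longrightarrow> planar_isotopic (switch D) (switch D')"
    unfolding planar_isotopic_def switch_sel by blast
  moreover have "move_I D D' \<Longrightarrow> move_I (switch D) (switch D')"
    unfolding move_I_def switch_sel using differ_in_disk_switch by blast
  ultimately show "move D D' \<Longrightarrow> move (switch D) (switch D')"
    unfolding move_def using long_virtual_diagram_switch move_II_switch move_III_switch by blast
qed

section \<open>Involutions on knots\<close>

lemma equivclp_map:
  assumes "\<And>x y. r x y \<Longrightarrow> r (f x) (f y)" and "equivclp r x y"
  shows "equivclp r (f x) (f y)"
proof -
  have sym: "symclp r (f x) (f y)" if "symclp r x y" for x y
    using that assms(1) by (auto simp: symclp_def)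
  from assms(2) show ?thesis unfolding equivclp_def
    by (induction rule: rtranclp_induct) (auto intro: rtranclp.rtrancl_into_rtrancl sym)
qed

lemma long_virtual_diagram_if_in_knot:
  assumes "K \<in> long_virtual_knots" and "D \<in> K"
  shows "long_virtual_diagram D"
proof -
  obtain D0 where D0: "long_virtual_diagram D0" "equivclp move D0 D"
    using assms by (auto simp: long_virtual_knots_def knot_of_def)
  from D0(2,1) show ?thesis unfolding equivclp_def
    by (induction rule: rtranclp_induct) (auto simp: symclp_def move_def)
qed

text \<open>
  If \<open>E\<close> is equivalent to \<open>f D\<close>, then \<open>f E\<close> is equivalent to \<open>f (f D) = D\<close>.
\<close>

lemma lift_to_knots_eq_image:
  assumes "K \<in> long_virtual_knots"
    and move: "\<And>D D'. move D D' \<Longrightarrow> move (f D) (f D')" and invol: "\<And>D. f (f D) = D"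
  shows "lift_to_knots f K = f ` K"
proof -
  obtain D0 where K: "K = {D. equivclp move D0 D}"
    using assms(1) by (auto simp: long_virtual_knots_def knot_of_def)
  show ?thesis
  proof (intro subset_antisym subsetI)
    fix E
    assume "E \<in> lift_to_knots f K"
    then obtain D where D: "equivclp move D0 D" "equivclp move (f D) E"
      by (auto simp: lift_to_knots_def K knot_of_def)
    have "equivclp move (f (f D)) (f E)"
      using move D(2) by (rule equivclp_map)
    then have "equivclp move D (f E)" by (simp only: invol)
    with D(1) have "f E \<in> K"
      unfolding K mem_Collect_eq by (rule transpD[OF transp_equivclp])
    then show "E \<in> f ` K" by (rule rev_image_eqI) (simp only: invol)
  next
    fix E
    assume "E \<in> f ` K"
    then show "E \<in> lift_to_knots f K"
      by (auto simp: lift_to_knots_def knot_of_def intro: reflpD[OF reflp_equivclp])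
  qed
qed

text \<open>
  The pairs of a diagram of the new knot and a realization of it are exactly the images
  of the pairs for \<open>K\<close> under the involutions \<open>f\<close> and \<open>r\<close>, so the sets of values correspond under \<open>\<tau>\<close>.
\<close>

lemma knot_invariant_lift:
  assumes K: "K \<in> long_virtual_knots"
    and move: "\<And>D D'. move D D' \<Longrightarrow> move (f D) (f D')" and f: "\<And>D. f (f D) = D"
    and long: "\<And>D. long_virtual_diagram D \<Longrightarrow> long_virtual_diagram (f D)"
    and r: "\<And>R. r (r R) = R"
    and real: "\<And>D R. long_virtual_diagram D \<Longrightarrow> surface_realization D R \<Longrightarrow>
      surface_realization (f D) (r R)"
    and \<tau>: "inj \<tau>" "\<tau> 0 = 0"
    and pq: "\<And>D R. long_virtual_diagram D \<Longrightarrow> surface_realization D R \<Longrightarrow> q (f D) (r R) = \<tau> (p D R)"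
  shows "knot_invariant q (lift_to_knots f K) = \<tau> (knot_invariant p K)"
  unfolding knot_invariant_def
proof (rule common_value_image[OF \<tau>])
  fix x
  have image: "lift_to_knots f K = f ` K"
    using K move f by (rule lift_to_knots_eq_image)
  note K_long = long_virtual_diagram_if_in_knot[OF K]
  show "(\<exists>D\<in>lift_to_knots f K. \<exists>R. surface_realization D R \<and> x = q D R) \<longleftrightarrow>
    (\<exists>y. (\<exists>D\<in>K. \<exists>R. surface_realization D R \<and> y = p D R) \<and> x = \<tau> y)" (is "?L \<longleftrightarrow> ?R")
  proof
    assume ?L
    then obtain E R where E: "E \<in> lift_to_knots f K" "surface_realization E R" "x = q E R"
      by (elim bexE exE conjE)
    from E(1) obtain D where "D \<in> K" "E = f D"
      unfolding image by (elim imageE)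
    with E(2,3) have D: "D \<in> K" "surface_realization (f D) R" "x = q (f D) R" by simp_all
    have "surface_realization D (r R)"
      using real[OF long[OF K_long[OF D(1)]] D(2)] by (simp only: f)
    moreover from pq[OF K_long[OF D(1)] this] have "x = \<tau> (p D (r R))"
      by (simp only: r D(3))
    ultimately show ?R using D(1) by (intro exI[of _ "p D (r R)"] conjI bexI[of _ D] exI[of _ "r R"] refl)
  next
    assume ?R
    then obtain y D R where "D \<in> K" "surface_realization D R" "y = p D R" "x = \<tau> y"
      by (elim bexE exE conjE)
    then have D: "D \<in> K" "surface_realization D R" "x = \<tau> (p D R)" by simp_all
    show ?L
    proof (intro bexI[of _ "f D"] exI[of _ "r R"] conjI)
      show "surface_realization (f D) (r R)" "x = q (f D) (r R)"
        using real[OF K_long[OF D(1)] D(2)] pq[OF K_long[OF D(1)] D(2)] D(3) by simp_all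
      show "f D \<in> lift_to_knots f K"
        unfolding image using D(1) by (rule imageI)
    qed
  qed
qed

section \<open>Polynomials of diagrams with corresponding crossings\<close>

text \<open>
  Two realized diagrams whose crossings correspond under \<open>h\<close> in such a way that types change by \<open>u\<close>,
  all signs are multiplied by \<open>\<delta>\<close> and all intersection numbers by \<open>\<kappa>\<close>. Every term of the three polynomials
  has two factors that are linear in the signs, so \<open>\<delta>\<close> cancels, while \<open>\<kappa>\<close> becomes a substitution.
\<close>

locale crossing_correspondence =
  fixes D D' :: diagram and R R' :: realization
    and h :: "real \<times> real \<Rightarrow> real \<times> real" and u :: "nat \<Rightarrow> nat" and \<delta> \<kappa> :: int
  assumes bij: "\<And>a. a \<in> {0, 1} \<Longrightarrow> bij_betw h (crossings_of_type D' a) (crossings_of_type D (u a))"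
    and sign: "\<And>i. i \<in> real_crossings D' \<Longrightarrow> crossing_sign D' i = \<delta> * crossing_sign D (h i)"
    and int_num: "\<And>i j \<gamma> \<gamma>'. i \<in> real_crossings D' \<Longrightarrow> j \<in> real_crossings D' \<Longrightarrow>
      \<gamma> \<in> {loop_alpha, loop_beta} \<Longrightarrow> \<gamma>' \<in> {loop_alpha, loop_beta} \<Longrightarrow>
      int_num R' (\<gamma> R' i) (\<gamma>' R' j) = \<kappa> * int_num R (\<gamma> R (h i)) (\<gamma>' R (h j))"
    and \<delta>: "\<delta> \<in> {1, - 1}" and \<kappa>: "\<kappa> \<in> {1, - 1}"
begin

lemma crossing: "i \<in> crossings_of_type D' a \<Longrightarrow> i \<in> real_crossings D'"
  by (simp add: crossings_of_type_def)

lemma writhe_eq: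
  assumes "a \<in> {0, 1}"
  shows "writhe D' a = \<delta> * writhe D (u a)"
  unfolding writhe_def sum_distrib_left
    sum.reindex_bij_betw[OF bij[OF assms], of "\<lambda>i. \<delta> * crossing_sign D i", symmetric]
  by (intro sum.cong refl sign crossing)

lemmas subst_rules = subst_power_of_int_mult[OF \<kappa>] subst_power_diff[OF \<kappa>] subst_power_1[OF \<kappa>]
  subst_power_t_pow[OF \<kappa>] subst_power_sum[OF \<kappa>]

lemma W_poly_eq:
  assumes "a \<in> {0, 1}"
  shows "W_poly a D' R' = of_int \<delta> * subst_power \<kappa> (W_poly (u a) D R)"
proof -
  have "subst_power \<kappa> (W_poly (u a) D R) = (\<Sum>i\<in>crossings_of_type D' a.
      of_int (crossing_sign D (h i)) * (t_pow (\<kappa> * int_num R (loop_alpha R (h i)) (loop_beta R (h i))) - 1))"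
    unfolding W_poly_def subst_rules by (rule sum.reindex_bij_betw[OF bij[OF assms], symmetric])
  then show ?thesis
    unfolding W_poly_def sum_distrib_left
    by (auto intro!: sum.cong simp: sign[OF crossing] int_num[OF crossing crossing] mult.assoc sum_distrib_left)
qed

lemma pair_sum_eq:
  assumes "a \<in> {0, 1}" and "b \<in> {0, 1}"
    and "\<gamma> \<in> {loop_alpha, loop_beta}" and "\<gamma>' \<in> {loop_alpha, loop_beta}"
  shows "pair_sum \<gamma> \<gamma>' a b D' R' = subst_power \<kappa> (pair_sum \<gamma> \<gamma>' (u a) (u b) D R)"
proof -
  have "subst_power \<kappa> (pair_sum \<gamma> \<gamma>' (u a) (u b) D R) =
    (\<Sum>i\<in>crossings_of_type D' a. \<Sum>j\<in>crossings_of_type D' b.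
      of_int (crossing_sign D (h i) * crossing_sign D (h j)) *
      (t_pow (\<kappa> * int_num R (\<gamma> R (h i)) (\<gamma>' R (h j))) - 1))"
    unfolding pair_sum_def subst_rules
    by (simp only: sum.reindex_bij_betw[OF bij[OF assms(1)], symmetric]
        sum.reindex_bij_betw[OF bij[OF assms(2)], symmetric])
  moreover have "crossing_sign D' i * crossing_sign D' j = crossing_sign D (h i) * crossing_sign D (h j)"
    if "i \<in> real_crossings D'" "j \<in> real_crossings D'" for i j
    using \<delta> by (auto simp: sign that)
  ultimately show ?thesis
    unfolding pair_sum_def
    by (simp only:) (intro sum.cong refl, simp only: crossing int_num[OF crossing crossing assms(3,4)])
qed

lemma F_poly_eq: "a \<in> {0, 1} \<Longrightarrow> b \<in> {0, 1} \<Longrightarrow> F_poly a b D' R' = subst_power \<kappa> (F_poly (u a) (u b) D R)"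
  by (simp add: F_poly_def pair_sum_eq)

lemma writhe_times_sign: "a \<in> {0, 1} \<Longrightarrow> of_int (writhe D' a) * (of_int \<delta> * p) = of_int (writhe D (u a)) * (p :: laurent)"
  using \<delta> by (auto simp: writhe_eq)

lemma G_poly_eq: "a \<in> {0, 1} \<Longrightarrow> b \<in> {0, 1} \<Longrightarrow> G_poly a b D' R' = subst_power \<kappa> (G_poly (u a) (u b) D R)"
  unfolding G_poly_def subst_rules
  by (simp only: pair_sum_eq W_poly_eq writhe_times_sign insertI1 insertI2)

lemma subst_inverse_W_poly_eq:
  assumes "a \<in> {0, 1}"
  shows "subst_inverse (W_poly a D' R') = of_int \<delta> * subst_power \<kappa> (subst_inverse (W_poly (u a) D R))"
proof -
  have "subst_inverse (subst_power \<kappa> p) = subst_power \<kappa> (subst_inverse p)" for p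
    using \<kappa> by (auto simp: subst_inverse_eq)
  then show ?thesis
    using subst_power_of_int_mult[of "- 1"] by (simp add: W_poly_eq[OF assms] subst_inverse_eq)
qed

lemma H_poly_eq: "a \<in> {0, 1} \<Longrightarrow> b \<in> {0, 1} \<Longrightarrow> H_poly a b D' R' = subst_power \<kappa> (H_poly (u a) (u b) D R)"
  unfolding H_poly_def subst_rules
  by (simp only: subst_inverse_W_poly_eq, simp only: pair_sum_eq W_poly_eq writhe_times_sign insertI1 insertI2)

end

section \<open>Surface realizations of the transformed diagrams\<close>

text \<open>
  Switching exchanges the two types because the two passages of a crossing happen at different times. This can be
  read off from a realization, whose parametrization sends a crossing to a double point.
\<close>

lemma crossing_passed_twice:
  assumes "surface_realization D R" and "(x, y) \<in> real_crossings D"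
  shows "x \<noteq> y"
proof -
  have "(param R x, param R y) \<in> double_points (knot R) \<inter> {0..<1} \<times> {0..<1}"
    using assms unfolding surface_realization_def
    by (elim conjE) (auto intro!: image_eqI[of _ _ "(x, y)"])
  then show ?thesis by (auto simp: double_points_def)
qed

lemma crossing_sign_switch: "crossing_sign (switch D) (x, y) = - crossing_sign D (y, x)"
proof -
  have "planar_cross v w = - planar_cross w v" for v w
    by (simp add: planar_cross_def)
  note swap = this[of "velocity (curve D) x" "velocity (curve D) y"]
  show ?thesis
    unfolding crossing_sign_def switch_sel prod.case swap by (simp add: floor_minus_sgn)
qed

text \<open>
  The same knot on the same surface realizes the switched diagram: exchanging the over and under strand
  negates the sign both in the plane and on the surface.
\<close>

lemma surface_realization_switch:
  assumes "surface_realization D R"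
  shows "surface_realization (switch D) R"
proof -
  have Field: "Field ((real_crossings D)\<inverse>) = Field (real_crossings D)" by (simp add: Field_def Un_commute)
  have cross: "surface_cross \<nu> p v w = - surface_cross \<nu> p w v" for \<nu> p v w
    by (simp add: surface_cross_def cross3_simps)
  have eq: "knot R (param R x) = knot R (param R y)" if "(x, y) \<in> real_crossings D" for x y
  proof -
    have "(param R x, param R y) \<in> double_points (knot R) \<inter> {0..<1} \<times> {0..<1}"
      using assms that unfolding surface_realization_def
      by (elim conjE) (auto intro!: image_eqI[of _ _ "(x, y)"])
    then show ?thesis by (auto simp: double_points_def)
  qed
  have "\<forall>(x, y) \<in> (real_crossings D)\<inverse>.
      surface_cross (normal R) (knot R (param R x))
        (velocity (knot R) (param R x)) (velocity (knot R) (param R y)) \<noteq> 0 \<and>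
      \<lfloor>sgn (surface_cross (normal R) (knot R (param R x))
        (velocity (knot R) (param R x)) (velocity (knot R) (param R y)))\<rfloor> = crossing_sign (switch D) (x, y)"
  proof (clarify, intro conjI)
    fix x y assume xy: "(y, x) \<in> real_crossings D"
    with assms have *: "surface_cross (normal R) (knot R (param R y))
        (velocity (knot R) (param R y)) (velocity (knot R) (param R x)) \<noteq> 0"
      "\<lfloor>sgn (surface_cross (normal R) (knot R (param R y))
        (velocity (knot R) (param R y)) (velocity (knot R) (param R x)))\<rfloor> = crossing_sign D (y, x)"
      unfolding surface_realization_def by auto
    have **: "surface_cross (normal R) (knot R (param R x))
        (velocity (knot R) (param R x)) (velocity (knot R) (param R y)) =
        - surface_cross (normal R) (knot R (param R y))
        (velocity (knot R) (param R y)) (velocity (knot R) (param R x))"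
      by (subst cross) (simp add: eq[OF xy])
    show "surface_cross (normal R) (knot R (param R x))
        (velocity (knot R) (param R x)) (velocity (knot R) (param R y)) \<noteq> 0"
      "\<lfloor>sgn (surface_cross (normal R) (knot R (param R x))
        (velocity (knot R) (param R x)) (velocity (knot R) (param R y)))\<rfloor> = crossing_sign (switch D) (x, y)"
      using * by (simp_all add: ** crossing_sign_switch floor_minus_sgn)
  qed
  with assms show ?thesis
    unfolding surface_realization_def switch_sel Field converse_converse
    by (simp only: Un_commute simp_thms)
qed

lemma crossing_type_swap:
  "x \<noteq> y \<Longrightarrow> a \<in> {0, 1} \<Longrightarrow> crossing_type (y, x) = a \<longleftrightarrow> crossing_type (x, y) = 1 - a"
  by (auto simp: crossing_type_def)

lemma bij_betw_converse_type:
  assumes "surface_realization D R" and "a \<in> {0, 1}"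
  shows "bij_betw prod.swap (crossings_of_type (switch D) a) (crossings_of_type D (1 - a))"
proof (rule bij_betw_byWitness[where f' = prod.swap])
  have "(y, x) \<in> crossings_of_type (switch D) a \<longleftrightarrow> (x, y) \<in> crossings_of_type D (1 - a)" for x y
    using crossing_type_swap[OF crossing_passed_twice[OF assms(1)] assms(2), of x y]
    by (simp add: crossings_of_type_def cong: conj_cong)
  then show "prod.swap ` crossings_of_type (switch D) a \<subseteq> crossings_of_type D (1 - a)"
    "prod.swap ` crossings_of_type D (1 - a) \<subseteq> crossings_of_type (switch D) a"
    by auto
qed auto

text \<open>
  The loops of a smoothing do not depend on which strand is the upper one.
\<close>

lemma crossing_correspondence_switch:
  assumes "surface_realization D R"
  shows "crossing_correspondence D (switch D) R R prod.swap (\<lambda>a. 1 - a) (- 1) 1"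
proof
  have swap: "\<gamma> R (prod.swap i) = \<gamma> R i" if "\<gamma> \<in> {loop_alpha, loop_beta}" for \<gamma> i
    using that by (cases i) (auto simp: loop_alpha_def loop_beta_def min.commute max.commute)
  show "int_num R (\<gamma> R i) (\<gamma>' R j) = 1 * int_num R (\<gamma> R (prod.swap i)) (\<gamma>' R (prod.swap j))"
    if "\<gamma> \<in> {loop_alpha, loop_beta}" "\<gamma>' \<in> {loop_alpha, loop_beta}" for \<gamma> \<gamma>' i j
    by (simp only: swap[OF that(1)] swap[OF that(2)] mult_1)
  show "crossing_sign (switch D) i = - 1 * crossing_sign D (prod.swap i)" for i
    by (cases i) (simp add: crossing_sign_switch)
qed (use bij_betw_converse_type[OF assms] in auto)

text \<open>
  Up to an orientation-reversing homeomorphism, the mirror image of a diagram on an oriented surface is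
  the same diagram on the surface with the opposite orientation.
\<close>

definition mirror_realization :: "realization \<Rightarrow> realization" where
  "mirror_realization R = R\<lparr>normal := (\<lambda>p. - normal R p)\<rparr>"

lemma mirror_realization_sel [simp]:
  "surf (mirror_realization R) = surf R" "normal (mirror_realization R) = (\<lambda>p. - normal R p)"
  "knot (mirror_realization R) = knot R" "param (mirror_realization R) = param R"
  by (simp_all add: mirror_realization_def)

lemma mirror_realization_involution: "mirror_realization (mirror_realization R) = R"
  by (simp add: mirror_realization_def)

lemma closed_oriented_surface_opposite:
  assumes "closed_oriented_surface S \<nu>"
  shows "closed_oriented_surface S (\<lambda>p. - \<nu> p)"
  unfolding closed_oriented_surface_def
proof (intro conjI ballI)
  show "S \<noteq> {}" "compact S" "connected S"
    using assms by (simp_all only: closed_oriented_surface_def simp_thms)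
  fix p
  assume p: "p \<in> S"
  have local: "\<forall>p\<in>S. \<exists>U f g. open U \<and> p \<in> U \<and>
      (\<forall>x\<in>U. (f has_derivative (\<lambda>v. g x \<bullet> v)) (at x) \<and> g x \<noteq> 0) \<and>
      continuous_on U g \<and> S \<inter> U = {x \<in> U. f x = (0::real)} \<and> (\<forall>x \<in> S \<inter> U. \<nu> x = sgn (g x))"
    using assms unfolding closed_oriented_surface_def by (elim conjE)
  from bspec[OF local p] obtain U f g where U: "open U" "p \<in> U"
      "\<forall>x\<in>U. (f has_derivative (\<lambda>v. g x \<bullet> v)) (at x) \<and> g x \<noteq> 0"
      "continuous_on U g" "S \<inter> U = {x \<in> U. f x = (0::real)}" "\<forall>x \<in> S \<inter> U. \<nu> x = sgn (g x)"
    by (elim exE conjE)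
  show "\<exists>U f g. open U \<and> p \<in> U \<and>
      (\<forall>x\<in>U. (f has_derivative (\<lambda>v. g x \<bullet> v)) (at x) \<and> g x \<noteq> 0) \<and>
      continuous_on U g \<and> S \<inter> U = {x \<in> U. f x = (0::real)} \<and> (\<forall>x \<in> S \<inter> U. - \<nu> x = sgn (g x))"
  proof (rule exI[of _ U], rule exI[of _ "\<lambda>x. - f x"], rule exI[of _ "\<lambda>x. - g x"], intro conjI ballI)
    show "((\<lambda>x. - f x) has_derivative (\<lambda>v. - g x \<bullet> v)) (at x)" "- g x \<noteq> 0" if "x \<in> U" for x
      using has_derivative_minus[of f "\<lambda>v. g x \<bullet> v"] bspec[OF U(3) that] by simp_all
    show "- \<nu> x = sgn (- g x)" if "x \<in> S \<inter> U" for x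
      using bspec[OF U(6) that] by (simp add: sgn_minus)
    show "S \<inter> U = {x \<in> U. - f x = 0}" using U(5) by simp
  qed (fact U(1,2) continuous_on_minus[OF U(4)])+
qed

lemma mirror_sel [simp]:
  "real_crossings (mirror D) = real_crossings D"
  by (simp add: mirror_def)

lemma crossing_sign_mirror:
  "long_virtual_diagram D \<Longrightarrow> crossing_sign (mirror D) i = - crossing_sign D i"
  using reflection.crossing_sign_transform[of D i] by (cases i) (simp add: mirror_eq_transform)

lemma surface_realization_mirror:
  assumes "long_virtual_diagram D" and "surface_realization D R"
  shows "surface_realization (mirror D) (mirror_realization R)"
  using assms(2) closed_oriented_surface_opposite[of "surf R" "normal R"]
  unfolding surface_realization_def mirror_realization_sel mirror_sel
  by (elim conjE, intro conjI; (assumption | simp add: case_prod_beta crossing_sign_mirror[OF assms(1)] floor_minus_sgn))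

lemma crossing_correspondence_mirror:
  assumes "long_virtual_diagram D"
  shows "crossing_correspondence D (mirror D) R (mirror_realization R) (\<lambda>i. i) (\<lambda>a. a) (- 1) (- 1)"
proof
  show "int_num (mirror_realization R) (\<gamma> (mirror_realization R) i) (\<gamma>' (mirror_realization R) j) =
      - 1 * int_num R (\<gamma> R i) (\<gamma>' R j)"
    if "\<gamma> \<in> {loop_alpha, loop_beta}" "\<gamma>' \<in> {loop_alpha, loop_beta}" for \<gamma> \<gamma>' i j
  proof -
    have "\<gamma> (mirror_realization R) i = \<gamma> R i" if "\<gamma> \<in> {loop_alpha, loop_beta}" for \<gamma> i
      using that by (auto simp: loop_alpha_def loop_beta_def)
    with that show ?thesis by (simp add: intersection_number_opposite_orientation)
  qed
  show "bij_betw (\<lambda>i. i) (crossings_of_type (mirror D) a) (crossings_of_type D a)" for a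
    by (simp add: crossings_of_type_def bij_betw_def)
qed (auto simp: crossing_sign_mirror[OF assms])

text \<open>
  The crossing at \<open>x\<close> of the reversed long diagram is the one at \<open>- x\<close> of the original diagram, and what the
  knot passes at time \<open>p\<close>, the reversed knot passes at time \<open>1 - p\<close>.
\<close>

definition reverse_realization :: "realization \<Rightarrow> realization" where
  "reverse_realization R = R\<lparr>knot := reversepath (knot R), param := (\<lambda>x. 1 - param R (- x))\<rparr>"

lemma reverse_realization_sel [simp]:
  "surf (reverse_realization R) = surf R" "normal (reverse_realization R) = normal R"
  "knot (reverse_realization R) = reversepath (knot R)"
  "param (reverse_realization R) = (\<lambda>x. 1 - param R (- x))"
  by (simp_all add: reverse_realization_def)

lemma reverse_realization_involution: "reverse_realization (reverse_realization R) = R"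
  by (simp add: reverse_realization_def)

lemma in_real_crossings_reverse: "(x, y) \<in> real_crossings (reverse D) \<longleftrightarrow> (- x, - y) \<in> real_crossings D"
  by (simp add: reverse_def)

lemma crossing_sign_reverse:
  "long_virtual_diagram D \<Longrightarrow> crossing_sign (reverse D) (x, y) = crossing_sign D (- x, - y)"
  using half_turn.crossing_sign_transform[of D "(x, y)"] by (simp add: reverse_eq_transform)

text \<open>
  Time reversal exchanges the ends \<open>0\<close> and \<open>1\<close> of the fundamental domain. Hence the double points have to be
  compared with care: a double point of the reversed knot with a parameter \<open>0\<close> would be one of the original knot
  at the basepoint, which does not exist. On the surface both velocities at a crossing are negated; in the plane
  both are kept, since the half turn cancels the effect of reversing the parameter. So signs agree.
\<close>

lemma surface_realization_reverse:
  assumes "long_virtual_diagram D" and "surface_realization D R"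
  shows "surface_realization (reverse D) (reverse_realization R)"
proof -
  define c p where "c = knot R" and "p = param R"
  define both where "both E = real_crossings E \<union> (real_crossings E)\<inverse>" for E :: diagram
  have R: "closed_oriented_surface (surf R) (normal R)" "immersion c" "closed_curve_on (surf R) c"
      "double_points c \<inter> {0..<1} \<times> {0..<1} = map_prod p p ` both D"
      "p ` Field (real_crossings D) \<subseteq> {0<..<1}" "strict_mono_on (Field (real_crossings D)) p"
    and crossings: "\<And>x y. (x, y) \<in> real_crossings D \<Longrightarrow>
        surface_cross (normal R) (c (p x)) (velocity c (p x)) (velocity c (p y)) \<noteq> 0 \<and>
        \<lfloor>sgn (surface_cross (normal R) (c (p x)) (velocity c (p x)) (velocity c (p y)))\<rfloor> = crossing_sign D (x, y)"
    using assms(2) unfolding surface_realization_def c_def p_def both_def by auto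
  have C1: "c C1_differentiable_on UNIV" and period: "c 1 = c 0"
    using R(3) by (auto simp: closed_curve_on_def) (metis add_0)
  have both_reverse: "(x, y) \<in> both (reverse D) \<longleftrightarrow> (- x, - y) \<in> both D" for x y
    by (simp add: both_def in_real_crossings_reverse)
  have p_range: "0 < p x" "p x < 1" "0 < p y" "p y < 1" if "(x, y) \<in> both D" for x y
  proof -
    have "x \<in> Field (real_crossings D)" "y \<in> Field (real_crossings D)"
      using that by (auto simp: both_def Field_def)
    then show "0 < p x" "p x < 1" "0 < p y" "p y < 1"
      using R(5) by auto
  qed
  have Field: "x \<in> Field (real_crossings (reverse D)) \<longleftrightarrow> - x \<in> Field (real_crossings D)" for x
  proof -
    have "(\<exists>y. (x, y) \<in> both (reverse D)) \<longleftrightarrow> (\<exists>y. (- x, y) \<in> both D)"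
      by (metis both_reverse minus_minus)
    then show ?thesis by (auto simp: both_def Field_def)
  qed
  have no_basepoint: False if "c 0 = c s" "0 < s" "s < 1" for s
  proof -
    have "(0, s) \<in> map_prod p p ` both D"
      unfolding R(4)[symmetric] using that by (simp add: double_points_def)
    then obtain x y where "(x, y) \<in> both D" "p x = 0" by auto
    then show False using p_range(1)[of x y] by simp
  qed
  have double: "double_points (reversepath c) \<inter> {0..<1} \<times> {0..<1}
      = map_prod (\<lambda>x. 1 - p (- x)) (\<lambda>x. 1 - p (- x)) ` both (reverse D)" (is "?L = ?R")
  proof (intro subset_antisym subsetI)
    fix z assume "z \<in> ?L"
    then obtain s t where st: "z = (s, t)" "s \<noteq> t" "s \<in> {0..<1}" "t \<in> {0..<1}" "c (1 - s) = c (1 - t)"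
      by (auto simp: double_points_def reversepath_def)
    have "s \<noteq> 0" using no_basepoint[of "1 - t"] st period by auto
    moreover have "t \<noteq> 0" using no_basepoint[of "1 - s"] st period by auto
    ultimately have "(1 - s, 1 - t) \<in> map_prod p p ` both D"
      unfolding R(4)[symmetric] using st by (auto simp: double_points_def)
    then obtain x y where xy: "(x, y) \<in> both D" "1 - s = p x" "1 - t = p y" by auto
    then have "(- x, - y) \<in> both (reverse D)" by (simp add: both_reverse)
    moreover have "z = map_prod (\<lambda>x. 1 - p (- x)) (\<lambda>x. 1 - p (- x)) (- x, - y)"
      using st(1) xy(2,3) by simp
    ultimately show "z \<in> ?R" by (rule rev_image_eqI)
  next
    fix z assume "z \<in> ?R"
    then obtain w where "w \<in> both (reverse D)" "z = map_prod (\<lambda>x. 1 - p (- x)) (\<lambda>x. 1 - p (- x)) w"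
      by (elim imageE)
    then obtain x y where xy: "(- x, - y) \<in> both D" "z = (1 - p (- x), 1 - p (- y))"
      by (cases w) (simp add: both_reverse)
    then have "(p (- x), p (- y)) \<in> double_points c \<inter> {0..<1} \<times> {0..<1}"
      unfolding R(4) by (intro image_eqI[of _ _ "(- x, - y)"]) auto
    then show "z \<in> ?L"
      using xy p_range[OF xy(1)] by (auto simp: double_points_def reversepath_def)
  qed
  have "immersion (reversepath c)"
    using immersion_affine_linear[OF bounded_linear_ident _ _ R(2), of "- 1" 1]
    by (simp add: reversepath_def[abs_def])
  moreover have "(\<lambda>x. 1 - p (- x)) ` Field (real_crossings (reverse D)) \<subseteq> {0<..<1}"
    using R(5) by (auto simp: Field image_subset_iff)
  moreover have "strict_mono_on (Field (real_crossings (reverse D))) (\<lambda>x. 1 - p (- x))"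
    using R(6) by (auto simp: strict_mono_on_def Field)
  moreover have "\<forall>(x, y)\<in>real_crossings (reverse D).
      surface_cross (normal R) (reversepath c (1 - p (- x))) (velocity (reversepath c) (1 - p (- x)))
        (velocity (reversepath c) (1 - p (- y))) \<noteq> 0 \<and>
      \<lfloor>sgn (surface_cross (normal R) (reversepath c (1 - p (- x))) (velocity (reversepath c) (1 - p (- x)))
        (velocity (reversepath c) (1 - p (- y))))\<rfloor> = crossing_sign (reverse D) (x, y)"
    using crossings
    by (auto simp: in_real_crossings_reverse velocity_reversepath[OF C1] crossing_sign_reverse[OF assms(1)])
      (auto simp: reversepath_def)
  ultimately show ?thesis
    using R(1) closed_curve_on_reversepath[OF R(3)] double
    unfolding surface_realization_def reverse_realization_sel c_def p_def both_def by blast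
qed

lemma subpath_reversepath: "subpath (1 - a) (1 - b) (reversepath c) = subpath a b c"
  by (auto simp: subpath_def reversepath_def algebra_simps)

text \<open>
  Both loops at a crossing are run through backwards. The second one passes through the basepoint, so
  the new loop and the reversed old one differ by a period.
\<close>

lemma crossing_correspondence_reverse:
  assumes "long_virtual_diagram D" and "surface_realization D R"
  shows "crossing_correspondence D (reverse D) R (reverse_realization R) (map_prod uminus uminus) (\<lambda>a. 1 - a) 1 1"
proof
  fix a :: nat
  assume a: "a \<in> {0, 1}"
  show "bij_betw (map_prod uminus uminus) (crossings_of_type (reverse D) a) (crossings_of_type D (1 - a))"
  proof (rule bij_betw_byWitness[where f' = "map_prod uminus uminus"])
    have crossing: "(- x, - y) \<in> crossings_of_type (reverse D) a \<longleftrightarrow> (x, y) \<in> crossings_of_type D (1 - a)" for x y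
    proof -
      have "crossing_type (- x, - y) = crossing_type (y, x)" by (simp add: crossing_type_def)
      then show ?thesis
        using crossing_type_swap[OF crossing_passed_twice[OF assms(2)] a, of x y]
        by (simp add: crossings_of_type_def in_real_crossings_reverse cong: conj_cong)
    qed
    then show "map_prod uminus uminus ` crossings_of_type D (1 - a) \<subseteq> crossings_of_type (reverse D) a"
      by auto
    show "map_prod uminus uminus ` crossings_of_type (reverse D) a \<subseteq> crossings_of_type D (1 - a)"
      using crossing[of "- x" "- y" for x y] by auto
  qed auto
next
  have curve: "closed_curve_on (surf R) (knot R)"
    using assms(2) by (simp add: surface_realization_def)
  then have periodic: "knot R (t + 1) = knot R t" for t by (simp add: closed_curve_on_def)
  have shift: "subpath (a + 1) (b + 1) (knot R) = subpath a b (knot R)" for a b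
    using periodic by (auto simp: subpath_def) (metis (no_types) add.assoc add.commute)
  have loop: "\<gamma> (reverse_realization R) i = reversepath (\<gamma> R (map_prod uminus uminus i))"
    if "\<gamma> \<in> {loop_alpha, loop_beta}" for \<gamma> i
  proof -
    obtain x y where i: "i = (x, y)" by fastforce
    have minmax: "min (- x) (- y) = - max x y" "max (- x) (- y) = - min x y" by auto
    show ?thesis
      using that shift[of "param R (- max x y)" "param R (- min x y) - 1"]
        subpath_reversepath[of "param R (- max x y)" "param R (- min x y) - 1" "knot R"]
      by (auto simp: i loop_alpha_def loop_beta_def minmax reversepath_subpath subpath_reversepath)
  qed
  show "int_num (reverse_realization R) (\<gamma> (reverse_realization R) i) (\<gamma>' (reverse_realization R) j) =
      1 * int_num R (\<gamma> R (map_prod uminus uminus i)) (\<gamma>' R (map_prod uminus uminus j))"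
    if "\<gamma> \<in> {loop_alpha, loop_beta}" "\<gamma>' \<in> {loop_alpha, loop_beta}" for \<gamma> \<gamma>' i j
    using loop[OF that(1)] loop[OF that(2)] by (simp add: intersection_number_reversepath)
  show "crossing_sign (reverse D) i = 1 * crossing_sign D (map_prod uminus uminus i)" for i
    by (cases i) (simp add: crossing_sign_reverse[OF assms(1)])
qed auto

section \<open>Behaviour of the invariants\<close>

text \<open>
  The form in which the three operations enter: what remains for each of them is its effect on
  realizations and crossings.
\<close>

lemma invariants_lift:
  assumes K: "K \<in> long_virtual_knots" and X: "X \<in> {F_inv, G_inv, H_inv}"
    and a: "a \<in> {0, 1}" and b: "b \<in> {0, 1}"
    and f: "\<And>D D'. move D D' \<Longrightarrow> move (f D) (f D')" "\<And>D. f (f D) = D"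
      "\<And>D. long_virtual_diagram D \<Longrightarrow> long_virtual_diagram (f D)"
    and r: "\<And>R. r (r R) = R"
      "\<And>D R. long_virtual_diagram D \<Longrightarrow> surface_realization D R \<Longrightarrow> surface_realization (f D) (r R)"
    and \<kappa>: "\<kappa> \<in> {1, - 1}"
    and corr: "\<And>D R. long_virtual_diagram D \<Longrightarrow> surface_realization D R \<Longrightarrow>
      crossing_correspondence D (f D) R (r R) h u \<delta> \<kappa>"
  shows "X a b (lift_to_knots f K) = subst_power \<kappa> (X (u a) (u b) K)"
proof -
  have lift: "knot_invariant (P a b) (lift_to_knots f K) = subst_power \<kappa> (knot_invariant (P (u a) (u b)) K)"
    if "\<And>D R. long_virtual_diagram D \<Longrightarrow> surface_realization D R \<Longrightarrow>
      P a b (f D) (r R) = subst_power \<kappa> (P (u a) (u b) D R)"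
    for P :: "nat \<Rightarrow> nat \<Rightarrow> diagram \<Rightarrow> realization \<Rightarrow> laurent"
    using K f r inj_subst_power[OF \<kappa>] subst_power_0[OF \<kappa>] that by (rule knot_invariant_lift)
  from X consider "X = F_inv" | "X = G_inv" | "X = H_inv" by blast
  then show ?thesis
  proof cases
    case 1
    have "X = (\<lambda>a b. knot_invariant (F_poly a b))" unfolding 1 by (intro ext) (simp only: F_inv_def)
    then show ?thesis
      using lift[of F_poly, OF crossing_correspondence.F_poly_eq[OF corr a b]] by simp
  next
    case 2
    have "X = (\<lambda>a b. knot_invariant (G_poly a b))" unfolding 2 by (intro ext) (simp only: G_inv_def)
    then show ?thesis
      using lift[of G_poly, OF crossing_correspondence.G_poly_eq[OF corr a b]] by simp
  next
    case 3
    have "X = (\<lambda>a b. knot_invariant (H_poly a b))" unfolding 3 by (intro ext) (simp only: H_inv_def)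
    then show ?thesis
      using lift[of H_poly, OF crossing_correspondence.H_poly_eq[OF corr a b]] by simp
  qed
qed

theorem theorem5p2:
  fixes K :: "diagram set"
    and X :: "nat \<Rightarrow> nat \<Rightarrow> diagram set \<Rightarrow> laurent"
    and a b :: nat
  assumes "K \<in> long_virtual_knots"
    and "X \<in> {F_inv, G_inv, H_inv}"
    and "a \<in> {0, 1}" and "b \<in> {0, 1}"
  shows "(X a b (lift_to_knots switch K) = X a b (lift_to_knots reverse K) \<and>
          X a b (lift_to_knots reverse K) = X (1 - a) (1 - b) K) \<and>
         X a b (lift_to_knots mirror K) = subst_inverse (X a b K)"
proof -
  note lift = invariants_lift[OF assms]
  have "X a b (lift_to_knots switch K) = subst_power 1 (X (1 - a) (1 - b) K)"
    by (rule lift[OF move_switch switch_switch long_virtual_diagram_switch refl _ _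
          crossing_correspondence_switch]) (simp_all add: surface_realization_switch)
  moreover have "X a b (lift_to_knots reverse K) = subst_power 1 (X (1 - a) (1 - b) K)"
    by (rule lift[where f = reverse, OF _ _ _ reverse_realization_involution surface_realization_reverse _
          crossing_correspondence_reverse])
      (simp_all add: reverse_eq_transform half_turn.move_transform half_turn.long_virtual_diagram_transform)
  moreover have "X a b (lift_to_knots mirror K) = subst_power (- 1) (X a b K)"
    by (rule lift[where f = mirror, OF _ _ _ mirror_realization_involution surface_realization_mirror _
          crossing_correspondence_mirror])
      (simp_all add: mirror_eq_transform reflection.move_transform reflection.long_virtual_diagram_transform)
  ultimately show ?thesis by (simp add: subst_inverse_eq)
qed

end
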